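(* Let $(\Omega,F,\mathbb{P})$ be a probability space, $L:\Omega\times\mathbb{R}^N\to\mathbb{R}$, and $\mathcal{L}(X)=\mathbb{E}_\omega[L(\omega,X)]$ for $X\in\mathbb{R}^N$. Suppose that for almost every $\omega\in\Omega$ the function $L(\omega,\cdot)$ is differentiable, and that the following two hypotheses hold: (a) there exist $C_0,C_1>0$ such that $\mathbb{E}_\omega\left[\|\nabla_X L(\omega,X)\|^2\right]\le C_0+C_1\|X\|^2$ for all $X\in\mathbb{R}^N$; (b) $\mathcal{L}$ is strongly convex: there exists $\mu>0$ such that $\mathcal{L}(Y)\ge\mathcal{L}(X)+\langle\nabla\mathcal{L}(X),Y-X\rangle+\frac{\mu}{2}\|X-Y\|^2$ for all $X,Y\in\mathbb{R}^N$. Let $(X_n)_{n\ge0}$ denote the iterates of the Stochastic Gradient Descent $X_{n+1}=X_n-\rho_n\nabla_X L(\omega_n,X_n)$ with learning rates $(\rho_n)_{n\ge 0}$, as described in the context. Then: 1. The function $\mathcal{L}$ has a unique minimum point $X_*\in\mathbb{R}^N$. 2. For $n\ge0$ denote $d_n=\mathbb{E}\left[\|X_n-X_*\|^2\right]$. Then there exist constants $c_0,c_1>0$ such that for all $n\ge0$, $$d_{n+1}\le(1-\rho_n\mu+\rho_n^2c_1)\,d_n+\rho_n^2c_0 .$$ 3. For any $\epsilon>0$ there exists $\rho_\epsilon>0$ such that if the learning rate is constant, $\rho_n=\rho$ for all $n$, with $0<\rho<\rho_\epsilon$, then $$\limsup_{n\to\infty}\mathbb{E}\left[\|X_{n+1}-X_*\|^2\right]\le\epsilon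 .$$ 4. If the sequence $(\rho_n)$ satisfies $\rho_n\to0$ and $\sum_{n\ge1}\rho_n=\infty$, then $d_n\to0$, that is, $\lim_{n\to\infty}X_n=X_*$ in the sense of $L^2$ convergence of random variables.
   Context: $\|\cdot\|$ and $\langle\cdot,\cdot\rangle$ are the Euclidean norm and inner product on $\mathbb{R}^N$. The function $L(\omega,X)$ depends on a random argument $\omega$ and a parameter $X\in\mathbb{R}^N$; $\nabla_X L$ is its gradient with respect to $X$. For each $X$, $L(\cdot,X)$ is measurable and integrable, so that $\mathcal{L}(X)=\mathbb{E}_\omega[L(\omega,X)]=\int_\Omega L(\omega,X)\,\mathbb{P}(d\omega)$ is a well-defined real number. Stochastic Gradient Descent (SGD): a sequence of deterministic positive learning rates $(\rho_n)_{n\ge0}$ is fixed a priori. One starts from an initial point $X_0$, an $\mathbb{R}^N$-valued random variable with $\mathbb{E}[\|X_0\|^2]<\infty$ (for instance a deterministic point). At iteration $n\ge0$ a random $\omega_n\in\Omega$ with law $\mathbb{P}$, independent of all previous random variables (that is, of $X_0,\omega_0,\dots,\omega_{n-1}$, hence also of $X_0,\dots,X_n$), is drawn, and one sets $X_{n+1}=X_n-\rho_n\nabla_X L(\omega_n,X_n)$. The expectations $\mathbb{E}$ in $d_n$ are over all the randomness in $X_0,\omega_0,\omega_1,\dots$. *)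

theory Defs
  imports "HOL-Probability.Probability"
begin

text \<open>Meaningful only where \<open>f\<close> is differentiable at \<open>x\<close>; the vector is then unique.\<close>

definition grad :: "('a::real_inner \<Rightarrow> real) \<Rightarrow> 'a \<Rightarrow> 'a" where
  "grad f x = (THE D. GDERIV f x :> D)"

lemma grad_eq:
  assumes "GDERIV f x :> D"
  shows "grad f x = D"
  unfolding grad_def
proof (rule the_equality)
  show "GDERIV f x :> D" by (rule assms)
next
  fix E assume "GDERIV f x :> E"
  then have "(\<lambda>h. h \<bullet> E) = (\<lambda>h. h \<bullet> D)"
    using assms unfolding gderiv_def by (rule has_derivative_unique)
  then show "E = D"
    by (metis inner_eq_zero_iff inner_diff_right eq_iff_diff_eq_0)
qed

definition expected_loss :: "'w measure \<Rightarrow> ('w \<Rightarrow> 'a \<Rightarrow> real) \<Rightarrow> 'a \<Rightarrow> real" where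
  "expected_loss M L x = (\<integral>w. L w x \<partial>M)"

text \<open>
  \<open>M\<close> is the law of each sample; \<open>P\<close> is the probability space carrying the initial
  point \<open>X 0\<close> and the samples \<open>\<omega> 0, \<omega> 1, \<dots>\<close>.  The generated sigma-algebras are used for
  independence because \<^const>\<open>prob_space.indep_var\<close> only relates random variables with
  values in the same type.  The recursion is required almost surely because
  the gradient of \<open>L w\<close> exists only for almost every \<open>w\<close>.
\<close>

definition sgd_iterates ::
  "'w measure \<Rightarrow> ('w \<Rightarrow> (real ^ 'n) \<Rightarrow> real) \<Rightarrow> (nat \<Rightarrow> real) \<Rightarrow>
   'z measure \<Rightarrow> (nat \<Rightarrow> 'z \<Rightarrow> 'w) \<Rightarrow> (nat \<Rightarrow> 'z \<Rightarrow> real ^ 'n) \<Rightarrow> bool" where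
  "sgd_iterates M L \<rho> P \<omega> X \<longleftrightarrow>
     prob_space P \<and>
     (\<forall>n. \<rho> n > 0) \<and>
     (\<forall>n. X n \<in> borel_measurable P) \<and>
     integrable P (\<lambda>z. (norm (X 0 z))\<^sup>2) \<and>
     (\<forall>n. \<omega> n \<in> P \<rightarrow>\<^sub>M M \<and> distr P M (\<omega> n) = M) \<and>
     (\<forall>n. prob_space.indep_set P
        (sets (vimage_algebra (space P) (\<lambda>z. (X 0 z, \<lambda>i\<in>{..<n}. \<omega> i z))
                 (borel \<Otimes>\<^sub>M (\<Pi>\<^sub>M i\<in>{..<n}. M))))
        (sets (vimage_algebra (space P) (\<omega> n) M))) \<and>
     (\<forall>n. AE z in P. X (Suc n) z = X n z - \<rho> n *\<^sub>R grad (L (\<omega> n z)) (X n z))"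

definition mean_sq_dist :: "'z measure \<Rightarrow> ('z \<Rightarrow> 'a::real_normed_vector) \<Rightarrow> 'a \<Rightarrow> real" where
  "mean_sq_dist P Y x = (\<integral>z. (norm (Y z - x))\<^sup>2 \<partial>P)"

end

theory Submission
  imports Defs
begin

text \<open>
  Everything rests on \<open>E \<langle>\<nabla>L(\<omega>, x), x - x\<^sub>*\<rangle> \<ge> (\<mu> / 2) \<parallel>x - x\<^sub>*\<parallel>\<^sup>2\<close>, for which the gradient and the
  expectation have to be interchanged.  By the fundamental theorem of calculus along segments and
  Fubini, the growth condition bounds the difference quotients of \<open>L(\<omega>, \<cdot>)\<close> in mean square, so they
  are uniformly integrable and their means converge to \<open>E \<langle>\<nabla>L(\<omega>, x), v\<rangle>\<close>; the strong convexity
  inequality, applied at \<open>x\<close> only, then bounds this limit from below.  Expanding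
  \<open>\<parallel>X\<^sub>n - \<rho>\<^sub>n \<nabla>L(\<omega>\<^sub>n, X\<^sub>n) - x\<^sub>*\<parallel>\<^sup>2\<close> and integrating over the independent \<open>\<omega>\<^sub>n\<close> first gives the
  recursion for \<open>d\<^sub>n\<close>.  Once \<open>\<rho>\<^sub>n\<close> is small it reads
  \<open>d\<^sub>n\<^sub>+\<^sub>1 - \<epsilon> \<le> (1 - \<mu> \<rho>\<^sub>n / 2) (d\<^sub>n - \<epsilon>)\<close>, and the product of these factors tends to \<open>0\<close> when
  \<open>\<Sum> \<rho>\<^sub>n\<close> diverges, which covers both constant and vanishing rates.
\<close>

subsection \<open>Gradients and difference quotients\<close>

text \<open>Replacing \<open>x\<close> by simple functions \<open>F i\<close> that converge to it
  leaves finitely many sections in \<open>w\<close>, each measurable; continuity in \<open>x\<close>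
  then carries joint measurability to the limit.\<close>

lemma borel_measurable_Caratheodory:
  fixes f :: "'w \<Rightarrow> 'a::{second_countable_topology, metric_space} \<Rightarrow> real"
  assumes meas: "\<And>x. (\<lambda>w. f w x) \<in> borel_measurable M"
    and cont: "\<And>w. w \<in> space M \<Longrightarrow> continuous_on UNIV (f w)"
  shows "(\<lambda>(w, x). f w x) \<in> borel_measurable (M \<Otimes>\<^sub>M borel)"
proof -
  have "(\<lambda>x::'a. x) \<in> borel_measurable borel" by simp
  from borel_measurable_implies_sequence_metric[OF this, of undefined] obtain F :: "nat \<Rightarrow> 'a \<Rightarrow> 'a"
    where F: "\<And>i. simple_function borel (F i)" "\<And>x. (\<lambda>i. F i x) \<longlonglongrightarrow> x"
    by (auto simp: space_borel)
  have "(\<lambda>p. f (fst p) (F i (snd p))) \<in> borel_measurable (M \<Otimes>\<^sub>M borel)" for i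
  proof (rule measurable_compose_countable'[where f = "\<lambda>y p. f (fst p) y" and g = "\<lambda>p. F i (snd p)" and I = "range (F i)"])
    show "countable (range (F i))"
      using F(1)[of i] by (auto simp: simple_function_def space_borel intro: countable_finite)
    have "F i \<in> borel \<rightarrow>\<^sub>M count_space (range (F i))"
      using measurable_simple_function[OF F(1)[of i]]
      by (auto simp: measurable_def space_borel)
    then show "(\<lambda>p. F i (snd p)) \<in> M \<Otimes>\<^sub>M borel \<rightarrow>\<^sub>M count_space (range (F i))"
      by measurable
    show "(\<lambda>p. f (fst p) y) \<in> borel_measurable (M \<Otimes>\<^sub>M borel)" for y
      using meas[of y] by measurable
  qed
  then have "(\<lambda>p. f (fst p) (snd p)) \<in> borel_measurable (M \<Otimes>\<^sub>M borel)"
  proof (rule borel_measurable_LIMSEQ_metric)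
    fix p assume "p \<in> space (M \<Otimes>\<^sub>M (borel :: 'a measure))"
    then have "fst p \<in> space M" by (auto simp: space_pair_measure)
    then have "isCont (f (fst p)) (snd p)"
      using cont continuous_on_eq_continuous_at open_UNIV by blast
    then show "(\<lambda>i. f (fst p) (F i (snd p))) \<longlonglongrightarrow> f (fst p) (snd p)"
      using F(2) isCont_tendsto_compose by blast
  qed
  then show ?thesis by (simp add: case_prod_unfold)
qed

text \<open>\<open>grad\<close> is a definite description, so the representing vector has to be
  exhibited: its coordinates are the values of the derivative on the basis (finite-dimensional Riesz
  representation).\<close>

lemma differentiable_imp_GDERIV_grad:
  fixes f :: "'a::euclidean_space \<Rightarrow> real"
  assumes "f differentiable (at x)"
  shows "GDERIV f x :> grad f x"
proof -
  obtain f' where f': "(f has_derivative f') (at x)"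
    using assms by (auto simp: differentiable_def)
  then interpret bounded_linear f' by (rule has_derivative_bounded_linear)
  have "f' h = h \<bullet> (\<Sum>b\<in>Basis. f' b *\<^sub>R b)" for h
  proof -
    have "f' h = f' (\<Sum>b\<in>Basis. (h \<bullet> b) *\<^sub>R b)" by (simp add: euclidean_representation)
    also have "\<dots> = h \<bullet> (\<Sum>b\<in>Basis. f' b *\<^sub>R b)"
      by (simp add: sum scaleR inner_sum_right mult.commute)
    finally show ?thesis .
  qed
  then have "f' = (\<lambda>h. h \<bullet> (\<Sum>b\<in>Basis. f' b *\<^sub>R b))" by (rule ext)
  then have "GDERIV f x :> (\<Sum>b\<in>Basis. f' b *\<^sub>R b)"
    using f' unfolding gderiv_def by metis
  then show ?thesis by (simp only: grad_eq)
qed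

lemma has_real_derivative_along_line:
  fixes f :: "'a::euclidean_space \<Rightarrow> real"
  assumes "f differentiable (at (x + t *\<^sub>R v))"
  shows "((\<lambda>s. f (x + s *\<^sub>R v)) has_real_derivative grad f (x + t *\<^sub>R v) \<bullet> v) (at t within S)"
proof -
  have "(f has_derivative (\<lambda>h. h \<bullet> grad f (x + t *\<^sub>R v))) (at (x + t *\<^sub>R v))"
    using differentiable_imp_GDERIV_grad[OF assms] by (simp add: gderiv_def)
  moreover have "((\<lambda>s. x + s *\<^sub>R v) has_derivative (\<lambda>h. h *\<^sub>R v)) (at t)"
    by (auto intro!: derivative_eq_intros)
  ultimately have "((\<lambda>s. f (x + s *\<^sub>R v)) has_derivative (\<lambda>h. (h *\<^sub>R v) \<bullet> grad f (x + t *\<^sub>R v))) (at t)"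
    by (rule has_derivative_compose[rotated])
  then have "((\<lambda>s. f (x + s *\<^sub>R v)) has_real_derivative grad f (x + t *\<^sub>R v) \<bullet> v) (at t)"
    by (simp add: has_field_derivative_def inner_commute mult.commute[of _ "v \<bullet> _"] mult_commute_abs)
  then show ?thesis by (rule has_field_derivative_at_within)
qed

text \<open>The steps run through \<open>1 / Suc n\<close> because measurability and convergence of
  integrals pass to limits of sequences; the shift avoids a zero step.\<close>

lemma difference_quotient_LIMSEQ:
  fixes f :: "'a::euclidean_space \<Rightarrow> real"
  assumes "f differentiable (at x)"
  shows "(\<lambda>n. real (Suc n) * (f (x + (1 / real (Suc n)) *\<^sub>R v) - f x)) \<longlonglongrightarrow> grad f x \<bullet> v"
proof -
  have "((\<lambda>s. f (x + s *\<^sub>R v)) has_real_derivative grad f x \<bullet> v) (at 0)"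
    using has_real_derivative_along_line[of f x 0 v UNIV] assms by simp
  then have "((\<lambda>h. (f (x + h *\<^sub>R v) - f x) / h) \<longlongrightarrow> grad f x \<bullet> v) (at 0)"
    unfolding DERIV_def by simp
  moreover have "filterlim (\<lambda>n. 1 / real (Suc n)) (at 0) sequentially"
    unfolding filterlim_at using LIMSEQ_inverse_real_of_nat by (auto simp: divide_inverse)
  ultimately have "(\<lambda>n. (f (x + (1 / real (Suc n)) *\<^sub>R v) - f x) / (1 / real (Suc n))) \<longlonglongrightarrow> grad f x \<bullet> v"
    by (rule filterlim_compose)
  then show ?thesis by (simp add: mult.commute)
qed

text \<open>Each coordinate of the gradient is a pointwise limit of difference quotients, which are
  jointly measurable by the Caratheodory argument. The limit is taken at every point of the product
  space, hence differentiability on all of \<open>space M\<close>.\<close>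

lemma borel_measurable_grad:
  fixes f :: "'w \<Rightarrow> 'a::euclidean_space \<Rightarrow> real"
  assumes meas: "\<And>x. (\<lambda>w. f w x) \<in> borel_measurable M"
    and diff: "\<And>w x. w \<in> space M \<Longrightarrow> f w differentiable (at x)"
  shows "(\<lambda>(w, x). grad (f w) x) \<in> borel_measurable (M \<Otimes>\<^sub>M borel)"
proof -
  have [measurable]: "(\<lambda>(w, x). f w x) \<in> borel_measurable (M \<Otimes>\<^sub>M borel)"
  proof (rule borel_measurable_Caratheodory[OF meas])
    show "continuous_on UNIV (f w)" if "w \<in> space M" for w
      using diff[OF that] by (simp add: continuous_on_eq_continuous_at differentiable_imp_continuous_within)
  qed
  have "(\<lambda>p. grad (f (fst p)) (snd p) \<bullet> b) \<in> borel_measurable (M \<Otimes>\<^sub>M borel)" for b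
  proof (rule borel_measurable_LIMSEQ_metric)
    show "(\<lambda>p. real (Suc n) * (f (fst p) (snd p + (1 / real (Suc n)) *\<^sub>R b) - f (fst p) (snd p)))
        \<in> borel_measurable (M \<Otimes>\<^sub>M borel)" for n
      by measurable
  next
    fix p assume "p \<in> space (M \<Otimes>\<^sub>M (borel :: 'a measure))"
    then have "fst p \<in> space M" by (auto simp: space_pair_measure)
    then show "(\<lambda>n. real (Suc n) * (f (fst p) (snd p + (1 / real (Suc n)) *\<^sub>R b) - f (fst p) (snd p)))
        \<longlonglongrightarrow> grad (f (fst p)) (snd p) \<bullet> b"
      by (intro difference_quotient_LIMSEQ diff)
  qed
  then show ?thesis by (subst borel_measurable_euclidean_space) (simp add: case_prod_unfold)
qed

text \<open>
  The derivative of an everywhere differentiable function is always gauge integrable, so no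
  integrability of \<open>f'\<close> has to be assumed; integrate \<open>2 m f' - m\<^sup>2 \<le> f'\<^sup>2\<close> with
  \<open>m = f 1 - f 0\<close>.
\<close>

lemma increment_power2_le_nn_integral:
  fixes f f' :: "real \<Rightarrow> real"
  assumes deriv: "\<And>t. (f has_real_derivative f' t) (at t within {0..1})"
    and [measurable]: "f' \<in> borel_measurable borel"
  shows "ennreal ((f 1 - f 0)\<^sup>2) \<le> (\<integral>\<^sup>+ t\<in>{0..1}. ennreal ((f' t)\<^sup>2) \<partial>lborel)"
proof (cases "(\<integral>\<^sup>+ t\<in>{0..1}. ennreal ((f' t)\<^sup>2) \<partial>lborel) = \<infinity>")
  case True
  then show ?thesis by simp
next
  case False
  define m where "m = f 1 - f 0"
  have eq: "(\<integral>\<^sup>+ t\<in>{0..1}. ennreal ((f' t)\<^sup>2) \<partial>lborel)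
      = (\<integral>\<^sup>+ t. ennreal (indicator {0..1} t * (f' t)\<^sup>2) \<partial>lborel)"
    by (intro nn_integral_cong) (auto simp: indicator_def)
  obtain r where r: "(\<integral>\<^sup>+ t. ennreal (indicator {0..1} t * (f' t)\<^sup>2) \<partial>lborel) = ennreal r" "0 \<le> r"
    using False unfolding eq
    by (cases "\<integral>\<^sup>+ t. ennreal (indicator {0..1} t * (f' t)\<^sup>2) \<partial>lborel" rule: ennreal_cases) auto
  have "((\<lambda>t. indicator {0..1} t * (f' t)\<^sup>2) has_integral r) UNIV"
    by (rule nn_integral_has_integral[OF _ _ r]) auto
  then have sq: "((\<lambda>t. (f' t)\<^sup>2) has_integral r) {0..1}"
    by (subst (asm) indicator_times_eq_if, subst (asm) has_integral_restrict_UNIV)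
  have "(f' has_integral m) {0..1}"
    unfolding m_def using deriv
    by (intro fundamental_theorem_of_calculus) (auto simp: has_real_derivative_iff_has_vector_derivative)
  then have "((\<lambda>t. 2 * m * f' t - m\<^sup>2) has_integral (2 * m * m - m\<^sup>2)) {0..1}"
    using has_integral_const_real[of "m\<^sup>2" 0 1]
    by (intro has_integral_diff has_integral_mult_right) auto
  from has_integral_le[OF this sq] have "2 * m * m - m\<^sup>2 \<le> r"
    using zero_le_power2[of "f' _ - m"] by (force simp: power2_diff algebra_simps)
  then have "m\<^sup>2 \<le> r" by (simp add: power2_eq_square)
  then show ?thesis unfolding eq r(1) m_def by (rule ennreal_leI)
qed

subsection \<open>Strong convexity and contractive recursions\<close>

text \<open>\<open>g\<close> acts as a choice of subgradients. Existence: a finite convex function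
  on a Euclidean space is continuous, and the quadratic term makes it coercive. Uniqueness: two
  minimum points are compared with their midpoint.\<close>

lemma strongly_convex_ex1_minimum:
  fixes f :: "'a::euclidean_space \<Rightarrow> real" and g :: "'a \<Rightarrow> 'a"
  assumes subgradient: "\<And>x y. f y \<ge> f x + g x \<bullet> (y - x) + \<mu> / 2 * (norm (x - y))\<^sup>2"
    and "0 < \<mu>"
  shows "\<exists>!x. \<forall>y. f x \<le> f y"
proof (rule ex_ex1I)
  have affine: "f y \<ge> f x + g x \<bullet> (y - x)" for x y
    using subgradient[of x y] \<open>0 < \<mu>\<close> by (smt (verit) divide_nonneg_nonneg mult_nonneg_nonneg zero_le_power2)
  have "convex_on UNIV f"
  proof (rule convex_onI)
    fix t :: real and x y :: 'a assume t: "0 < t" "t < 1"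
    \<comment> \<open>Subgradient inequalities from the intermediate point to both ends: weighted by
      \<open>1 - t\<close> and \<open>t\<close>, their linear terms cancel.\<close>
    define z where "z = (1 - t) *\<^sub>R x + t *\<^sub>R y"
    have "(1 - t) *\<^sub>R (x - z) + t *\<^sub>R (y - z) = 0" unfolding z_def by (simp add: algebra_simps)
    then have "g z \<bullet> ((1 - t) *\<^sub>R (x - z) + t *\<^sub>R (y - z)) = 0" by simp
    then have zero: "(1 - t) * (g z \<bullet> (x - z)) + t * (g z \<bullet> (y - z)) = 0"
      by (simp only: inner_add_right inner_scaleR_right)
    have "(1 - t) * (f z + g z \<bullet> (x - z)) + t * (f z + g z \<bullet> (y - z)) \<le> (1 - t) * f x + t * f y"
      using t by (intro add_mono mult_left_mono affine) auto
    then show "f ((1 - t) *\<^sub>R x + t *\<^sub>R y) \<le> (1 - t) * f x + t * f y"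
      using zero unfolding z_def[symmetric] by (simp add: algebra_simps)
  qed simp
  then have cont: "continuous_on UNIV f" by (intro convex_on_continuous) auto
  \<comment> \<open>Beyond this radius the quadratic term outweighs the linear term
    \<open>g 0 \<bullet> y\<close>, so \<open>f y\<close> is at least \<open>f 0\<close> and a
    minimum over the ball is global.\<close>
  define R where "R = 2 * norm (g 0) / \<mu>"
  have "0 \<le> R" unfolding R_def using \<open>0 < \<mu>\<close> by simp
  then obtain x where x: "x \<in> cball 0 R" "\<And>y. y \<in> cball 0 R \<Longrightarrow> f x \<le> f y"
    using continuous_attains_inf[of "cball 0 R" f] continuous_on_subset[OF cont] by auto
  have "f x \<le> f y" for y
  proof (cases "norm y \<le> R")
    case False
    then have "2 * norm (g 0) \<le> \<mu> * norm y" unfolding R_def using \<open>0 < \<mu>\<close> by (simp add: field_simps)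
    then have "norm (g 0) * norm y \<le> \<mu> / 2 * norm y * norm y" by (intro mult_right_mono) auto
    moreover have "- (norm (g 0) * norm y) \<le> g 0 \<bullet> y" using Cauchy_Schwarz_ineq2[of "g 0" y] by linarith
    ultimately have "f 0 \<le> f y" using subgradient[of 0 y] by (simp add: power2_eq_square)
    then show ?thesis using x(2)[of 0] \<open>0 \<le> R\<close> by simp
  qed (use x(2)[of y] in simp)
  then show "\<exists>x. \<forall>y. f x \<le> f y" by blast
next
  fix x y assume min: "\<forall>z. f x \<le> f z" "\<forall>z. f y \<le> f z"
  define m where "m = (1 / 2) *\<^sub>R (x + y)"
  \<comment> \<open>By symmetry about the midpoint the two linear terms cancel, so only the
    quadratic ones remain, and minimality forces them to vanish.\<close>
  have "y - m = - (x - m)" unfolding m_def by (simp add: algebra_simps flip: scaleR_add_left)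
  then have "f x + f y \<ge> 2 * f m + \<mu> / 2 * (norm (m - x))\<^sup>2 + \<mu> / 2 * (norm (m - y))\<^sup>2"
    using subgradient[of m x] subgradient[of m y] by (simp add: inner_diff_right)
  moreover have "f x \<le> f m" "f y \<le> f m" using min by auto
  moreover have "0 \<le> \<mu> / 2 * (norm (m - x))\<^sup>2" "0 \<le> \<mu> / 2 * (norm (m - y))\<^sup>2" using \<open>0 < \<mu>\<close> by auto
  ultimately have "\<mu> / 2 * (norm (m - x))\<^sup>2 = 0" "\<mu> / 2 * (norm (m - y))\<^sup>2 = 0" by linarith+
  then show "x = y" using \<open>0 < \<mu>\<close> by simp
qed

text \<open>The excess of \<open>d\<close> over \<open>e\<close> is multiplied by at most
  \<open>1 - a n \<le> exp (- a n)\<close> at each step, so it decays like the exponential of minus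
  a divergent sum.\<close>

lemma contraction_eventually_le:
  fixes d a :: "nat \<Rightarrow> real"
  assumes step: "\<And>n. n \<ge> N \<Longrightarrow> d (Suc n) \<le> (1 - a n) * d n + a n * e"
    and a: "\<And>n. n \<ge> N \<Longrightarrow> 0 \<le> a n" "\<And>n. n \<ge> N \<Longrightarrow> a n \<le> 1"
    and diverges: "filterlim (\<lambda>m. \<Sum>n=1..m. a n) at_top sequentially"
    and "0 < \<delta>"
  shows "eventually (\<lambda>n. d n \<le> e + \<delta>) sequentially"
proof -
  \<comment> \<open>The positive part is taken because the factor \<open>1 - a n\<close> may be
    enlarged to \<open>exp (- a n)\<close> only in front of a nonnegative quantity.\<close>
  define u where "u n = max 0 (d n - e)" for n
  define s where "s n = (\<Sum>i<n. a i)" for n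
  have u_step: "u (Suc n) \<le> exp (- a n) * u n" if "n \<ge> N" for n
  proof -
    have "(1 - a n) * (d n - e) \<le> (1 - a n) * u n"
      using a(2)[OF that] by (intro mult_left_mono) (auto simp: u_def)
    then have "d (Suc n) - e \<le> (1 - a n) * u n"
      using step[OF that] by (simp add: algebra_simps)
    moreover have "0 \<le> (1 - a n) * u n" using a(2)[OF that] by (simp add: u_def)
    moreover have "(1 - a n) * u n \<le> exp (- a n) * u n"
      using exp_ge_add_one_self[of "- a n"] by (intro mult_right_mono) (auto simp: u_def)
    ultimately show ?thesis unfolding u_def[of "Suc n"] by linarith
  qed
  have bound: "u n \<le> u N * exp (s N) * exp (- s n)" if "n \<ge> N" for n
    using that
  proof (induction n rule: dec_induct)
    case base
    then show ?case by (simp add: mult.assoc flip: exp_add)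
  next
    case (step n)
    have "u (Suc n) \<le> exp (- a n) * u n" using u_step step.hyps by simp
    also have "\<dots> \<le> exp (- a n) * (u N * exp (s N) * exp (- s n))"
      using step.IH by (intro mult_left_mono) auto
    also have "\<dots> = u N * exp (s N) * exp (- s (Suc n))"
      by (simp add: s_def exp_diff exp_minus field_simps exp_add)
    finally show ?case .
  qed
  \<comment> \<open>The partial sums \<open>s\<close> start at index 0, the divergence hypothesis at
    index 1; the two differ by the constant \<open>a 0\<close>.\<close>
  have "s (Suc m) = a 0 + (\<Sum>n=1..m. a n)" for m
    unfolding s_def by (induction m) auto
  then have "filterlim (\<lambda>m. s (Suc m)) at_top sequentially"
    using filterlim_tendsto_add_at_top[OF tendsto_const diverges, of "a 0"] by simp
  then have "filterlim s at_top sequentially" by (rule filterlim_sequentially_Suc[THEN iffD1])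
  then have "(\<lambda>n. exp (- s n)) \<longlonglongrightarrow> 0"
    by (intro filterlim_compose[OF exp_at_bot]) (simp add: filterlim_uminus_at_bot)
  from tendsto_mult_right_zero[OF this, of "u N * exp (s N)"]
  have "eventually (\<lambda>n. u N * exp (s N) * exp (- s n) < \<delta>) sequentially"
    using \<open>0 < \<delta>\<close> by (rule order_tendstoD)
  with eventually_ge_at_top[of N] show ?thesis
  proof eventually_elim
    case (elim n)
    then show ?case using bound[of n] by (simp add: u_def)
  qed
qed

text \<open>The three smallness conditions have separate purposes: the first absorbs the
  \<open>c\<^sub>1\<close> term into half of \<open>\<rho> n * \<mu>\<close>, the second keeps the
  contraction factor nonnegative, the third bounds the noise term by
  \<open>\<mu> / 2 * \<rho> n * e\<close>.\<close>

lemma sgd_recursion_eventually_le: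
  fixes d \<rho> :: "nat \<Rightarrow> real"
  assumes step: "\<And>n. d (Suc n) \<le> (1 - \<rho> n * \<mu> + (\<rho> n)\<^sup>2 * c\<^sub>1) * d n + (\<rho> n)\<^sup>2 * c\<^sub>0"
    and nonneg: "\<And>n. 0 \<le> d n" "\<And>n. 0 \<le> \<rho> n"
    and "0 < \<mu>"
    and small: "eventually (\<lambda>n. \<rho> n * c\<^sub>1 \<le> \<mu> / 2 \<and> \<rho> n * \<mu> \<le> 2 \<and> 2 * \<rho> n * c\<^sub>0 \<le> \<mu> * e) sequentially"
    and diverges: "filterlim (\<lambda>m. \<Sum>n=1..m. \<rho> n) at_top sequentially"
    and "0 < \<delta>"
  shows "eventually (\<lambda>n. d n \<le> e + \<delta>) sequentially"
proof -
  obtain N where N: "\<And>n. n \<ge> N \<Longrightarrow> \<rho> n * c\<^sub>1 \<le> \<mu> / 2 \<and> \<rho> n * \<mu> \<le> 2 \<and> 2 * \<rho> n * c\<^sub>0 \<le> \<mu> * e"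
    using small by (auto simp: eventually_sequentially)
  show ?thesis
  proof (rule contraction_eventually_le[where a = "\<lambda>n. \<mu> / 2 * \<rho> n" and N = N])
    fix n assume "n \<ge> N"
    from N[OF this] have n: "\<rho> n * c\<^sub>1 \<le> \<mu> / 2" "\<rho> n * \<mu> \<le> 2" "2 * \<rho> n * c\<^sub>0 \<le> \<mu> * e" by auto
    show "0 \<le> \<mu> / 2 * \<rho> n" using \<open>0 < \<mu>\<close> nonneg(2)[of n] by simp
    show "\<mu> / 2 * \<rho> n \<le> 1" using n(2) by (simp add: mult.commute)
    have "(\<rho> n)\<^sup>2 * c\<^sub>1 \<le> \<mu> / 2 * \<rho> n"
      using mult_left_mono[OF n(1) nonneg(2)[of n]] by (simp add: power2_eq_square mult_ac)
    then have "(1 - \<rho> n * \<mu> + (\<rho> n)\<^sup>2 * c\<^sub>1) * d n \<le> (1 - \<mu> / 2 * \<rho> n) * d n"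
      using nonneg(1)[of n] by (intro mult_right_mono) (auto simp: algebra_simps)
    moreover have "(\<rho> n)\<^sup>2 * c\<^sub>0 \<le> \<mu> / 2 * \<rho> n * e"
      using mult_left_mono[OF n(3) nonneg(2)[of n]] by (simp add: power2_eq_square mult_ac)
    ultimately show "d (Suc n) \<le> (1 - \<mu> / 2 * \<rho> n) * d n + \<mu> / 2 * \<rho> n * e"
      using step[of n] by linarith
  next
    show "filterlim (\<lambda>m. \<Sum>n=1..m. \<mu> / 2 * \<rho> n) at_top sequentially"
      using filterlim_tendsto_pos_mult_at_top[OF tendsto_const _ diverges, of "\<mu> / 2"] \<open>0 < \<mu>\<close>
      by (simp add: sum_distrib_left)
  qed fact
qed

subsection \<open>Square-integrable random variables and independence\<close>

text \<open>Independence gives the product formula on measurable rectangles, which determine the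
  joint law. Stating it for a sigma-algebra \<open>A\<close> allows any \<open>A\<close>-measurable
  \<open>Y\<close>, without writing \<open>Y\<close> as a function of generators.\<close>

lemma (in prob_space) distr_pair_eq_pair_measure:
  assumes space: "space A = space M" and Y: "Y \<in> A \<rightarrow>\<^sub>M N" and W: "W \<in> M \<rightarrow>\<^sub>M K"
    and indep: "indep_set (sets A) (sets (vimage_algebra (space M) W K))"
  shows "distr M (N \<Otimes>\<^sub>M K) (\<lambda>z. (Y z, W z)) = distr M N Y \<Otimes>\<^sub>M distr M K W"
proof -
  \<comment> \<open>Independence includes that \<open>A\<close> consists of events, so measurability
    with respect to \<open>A\<close> implies measurability with respect to \<open>M\<close>.\<close>
  have "sets A \<subseteq> events" using indep by (simp add: indep_set_def indep_sets2_eq[unfolded indep_set_def])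
  then have Y_M [measurable]: "Y \<in> M \<rightarrow>\<^sub>M N" using Y space by (auto simp: measurable_def)
  note [measurable] = W
  interpret Y: prob_space "distr M N Y" by (rule prob_space_distr) fact
  interpret W: prob_space "distr M K W" by (rule prob_space_distr) fact
  show ?thesis
  proof (rule pair_measure_eqI[symmetric])
    show "sigma_finite_measure (distr M N Y)" "sigma_finite_measure (distr M K W)" by unfold_locales
    show "sets (distr M N Y \<Otimes>\<^sub>M distr M K W) = sets (distr M (N \<Otimes>\<^sub>M K) (\<lambda>z. (Y z, W z)))"
      by (simp cong: sets_pair_measure_cong)
    fix a b assume "a \<in> sets (distr M N Y)" "b \<in> sets (distr M K W)"
    then have [measurable]: "a \<in> sets N" "b \<in> sets K" by auto
    have "Y -` a \<inter> space M \<in> sets A" using measurable_sets[OF Y, of a] space by simp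
    moreover have "W -` b \<inter> space M \<in> sets (vimage_algebra (space M) W K)" by (rule in_vimage_algebra) simp
    ultimately have "prob ((Y -` a \<inter> space M) \<inter> (W -` b \<inter> space M)) = prob (Y -` a \<inter> space M) * prob (W -` b \<inter> space M)"
      using indep by (intro indep_setD)
    moreover have "(\<lambda>z. (Y z, W z)) -` (a \<times> b) \<inter> space M = (Y -` a \<inter> space M) \<inter> (W -` b \<inter> space M)" by auto
    ultimately show "emeasure (distr M N Y) a * emeasure (distr M K W) b
        = emeasure (distr M (N \<Otimes>\<^sub>M K) (\<lambda>z. (Y z, W z))) (a \<times> b)"
      by (simp add: emeasure_distr emeasure_eq_measure ennreal_mult)
  qed
qed

lemma (in prob_space) square_integrableI:
  fixes f :: "'a \<Rightarrow> real"
  assumes [measurable]: "f \<in> borel_measurable M"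
    and bound: "(\<integral>\<^sup>+ w. ennreal ((f w)\<^sup>2) \<partial>M) \<le> ennreal K" and "0 \<le> K"
  shows "integrable M (\<lambda>w. (f w)\<^sup>2)" "integrable M f" "(\<integral>w. (f w)\<^sup>2 \<partial>M) \<le> K"
proof -
  show sq: "integrable M (\<lambda>w. (f w)\<^sup>2)"
    by (rule integrableI_bounded) (use le_less_trans[OF bound ennreal_less_top] in auto)
  then show "integrable M f" by (rule square_integrable_imp_integrable[rotated]) simp
  have "ennreal (\<integral>w. (f w)\<^sup>2 \<partial>M) \<le> ennreal K"
    using nn_integral_eq_integral[OF sq] bound by simp
  then show "(\<integral>w. (f w)\<^sup>2 \<partial>M) \<le> K" using \<open>0 \<le> K\<close> by simp
qed

text \<open>
  \<open>h \<le> min h c + h\<^sup>2 / c\<close> for \<open>h = \<bar>f n - g\<bar>\<close>: the first term is dominated, the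
  second is small in mean for large \<open>c\<close>.
\<close>

lemma (in prob_space) integral_LIMSEQ_L2_bounded:
  fixes f :: "nat \<Rightarrow> 'a \<Rightarrow> real"
  assumes meas: "\<And>n. f n \<in> borel_measurable M" "g \<in> borel_measurable M"
    and lim: "AE w in M. (\<lambda>n. f n w) \<longlonglongrightarrow> g w"
    and bound: "\<And>n. (\<integral>\<^sup>+ w. ennreal ((f n w)\<^sup>2) \<partial>M) \<le> ennreal K"
      "(\<integral>\<^sup>+ w. ennreal ((g w)\<^sup>2) \<partial>M) \<le> ennreal K"
    and "0 \<le> K"
  shows "(\<lambda>n. \<integral>w. f n w \<partial>M) \<longlonglongrightarrow> (\<integral>w. g w \<partial>M)"
proof (rule LIMSEQ_I)
  fix e :: real assume "0 < e"
  note [measurable] = meas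
  note f = square_integrableI[OF meas(1) bound(1) \<open>0 \<le> K\<close>]
  note g = square_integrableI[OF meas(2) bound(2) \<open>0 \<le> K\<close>]
  define h where "h n w = \<bar>f n w - g w\<bar>" for n w
  have [measurable]: "h n \<in> borel_measurable M" for n unfolding h_def by measurable
  have int_h: "integrable M (h n)" for n
    unfolding h_def by (intro integrable_abs Bochner_Integration.integrable_diff f g)
  have int_sum: "integrable M (\<lambda>w. 2 * (f n w)\<^sup>2 + 2 * (g w)\<^sup>2)" for n
    by (intro Bochner_Integration.integrable_add integrable_mult_right f g)
  have h_le: "(h n w)\<^sup>2 \<le> 2 * (f n w)\<^sup>2 + 2 * (g w)\<^sup>2" for n w
    using zero_le_power2[of "f n w + g w"] by (simp add: h_def power2_sum power2_diff)
  have int_h2: "integrable M (\<lambda>w. (h n w)\<^sup>2)" for n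
    by (rule Bochner_Integration.integrable_bound[OF int_sum]) (use h_le in \<open>auto intro!: AE_I2\<close>)
  have h2: "(\<integral>w. (h n w)\<^sup>2 \<partial>M) \<le> 4 * K" for n
  proof -
    have "(\<integral>w. (h n w)\<^sup>2 \<partial>M) \<le> (\<integral>w. 2 * (f n w)\<^sup>2 + 2 * (g w)\<^sup>2 \<partial>M)"
      by (intro integral_mono int_h2 int_sum h_le)
    also have "\<dots> = 2 * (\<integral>w. (f n w)\<^sup>2 \<partial>M) + 2 * (\<integral>w. (g w)\<^sup>2 \<partial>M)"
      using f(1) g(1) by simp
    finally show ?thesis using f(3)[of n] g(3) by linarith
  qed
  \<comment> \<open>Chosen so that the mean of \<open>h\<^sup>2 / c\<close>, at most
    \<open>4 * K / c\<close>, stays below \<open>e / 2\<close>; the summand 1 keeps \<open>c\<close>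
    positive when \<open>K = 0\<close>.\<close>
  define c where "c = 8 * K / e + 1"
  have "1 \<le> c" unfolding c_def using \<open>0 < e\<close> \<open>0 \<le> K\<close> by simp
  have "8 * K < c * e" unfolding c_def using \<open>0 < e\<close> by (simp add: field_simps)
  then have tail: "4 * K / c < e / 2" using \<open>1 \<le> c\<close> by (simp add: field_simps)
  have "(\<lambda>n. \<integral>w. min (h n w) c \<partial>M) \<longlonglongrightarrow> (\<integral>w. 0 \<partial>M)"
  proof (rule integral_dominated_convergence[where w = "\<lambda>_. c"])
    show "AE w in M. (\<lambda>n. min (h n w) c) \<longlonglongrightarrow> 0"
      using lim
    proof eventually_elim
      case (elim w)
      then have "(\<lambda>n. min (h n w) c) \<longlonglongrightarrow> min \<bar>g w - g w\<bar> c"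
        unfolding h_def by (intro tendsto_intros)
      then show ?case using \<open>1 \<le> c\<close> by simp
    qed
    show "AE w in M. norm (min (h n w) c) \<le> c" for n
      using \<open>1 \<le> c\<close> by (intro AE_I2) (auto simp: h_def)
  qed auto
  then obtain N where N: "\<And>n. n \<ge> N \<Longrightarrow> \<bar>\<integral>w. min (h n w) c \<partial>M\<bar> < e / 2"
    using \<open>0 < e\<close> LIMSEQ_D[of "\<lambda>n. \<integral>w. min (h n w) c \<partial>M" 0 "e / 2"] by auto
  have "norm ((\<integral>w. f n w \<partial>M) - (\<integral>w. g w \<partial>M)) < e" if "n \<ge> N" for n
  proof -
    have int_min: "integrable M (\<lambda>w. min (h n w) c)"
      by (rule Bochner_Integration.integrable_bound[OF int_h[of n]])
         (use \<open>1 \<le> c\<close> in \<open>auto simp: h_def\<close>)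
    have "norm ((\<integral>w. f n w \<partial>M) - (\<integral>w. g w \<partial>M)) = \<bar>\<integral>w. f n w - g w \<partial>M\<bar>"
      using f(2) g(2) by simp
    also have "\<dots> \<le> (\<integral>w. h n w \<partial>M)"
      unfolding h_def by (rule integral_abs_bound)
    also have "\<dots> \<le> (\<integral>w. min (h n w) c + (h n w)\<^sup>2 / c \<partial>M)"
    proof (intro integral_mono int_h Bochner_Integration.integrable_add int_min)
      show "integrable M (\<lambda>w. (h n w)\<^sup>2 / c)" using int_h2 by simp
      show "h n w \<le> min (h n w) c + (h n w)\<^sup>2 / c" for w
      proof (cases "h n w \<le> c")
        case False
        then have "h n w * c \<le> h n w * h n w" using \<open>1 \<le> c\<close> by (intro mult_left_mono) auto
        then have "h n w \<le> (h n w)\<^sup>2 / c" using \<open>1 \<le> c\<close> by (simp add: power2_eq_square pos_le_divide_eq)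
        then show ?thesis using False \<open>1 \<le> c\<close> by simp
      qed (use \<open>1 \<le> c\<close> in auto)
    qed
    also have "\<dots> = (\<integral>w. min (h n w) c \<partial>M) + (\<integral>w. (h n w)\<^sup>2 \<partial>M) / c"
      using int_min int_h2 by simp
    also have "\<dots> < e / 2 + e / 2"
    proof (rule add_less_le_mono)
      show "(\<integral>w. min (h n w) c \<partial>M) < e / 2" using N[OF that] by linarith
      show "(\<integral>w. (h n w)\<^sup>2 \<partial>M) / c \<le> e / 2"
        using divide_right_mono[OF h2[of n], of c] \<open>1 \<le> c\<close> tail by linarith
    qed
    finally show ?thesis by simp
  qed
  then show "\<exists>N. \<forall>n\<ge>N. norm ((\<integral>w. f n w \<partial>M) - (\<integral>w. g w \<partial>M)) < e" by blast
qed

subsection \<open>Interchanging gradient and expectation\<close>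

text \<open>Differentiability is required at every sample because joint measurability of the
  gradient rests on it; \<open>ex_differentiable_loss_AE_eq\<close> reduces the almost sure case to
  this one. Bounding the nonnegative integral also yields square integrability, which a bound on the
  Bochner integral would not.\<close>

locale differentiable_loss = prob_space M for M :: "'w measure" +
  fixes L :: "'w \<Rightarrow> 'a::euclidean_space \<Rightarrow> real" and C\<^sub>0 C\<^sub>1 :: real
  assumes integrable_L: "\<And>x. integrable M (\<lambda>w. L w x)"
    and differentiable_L: "\<And>w x. w \<in> space M \<Longrightarrow> L w differentiable (at x)"
    and C\<^sub>0_nonneg: "0 \<le> C\<^sub>0" and C\<^sub>1_nonneg: "0 \<le> C\<^sub>1"
    and growth: "\<And>x. (\<integral>\<^sup>+ w. ennreal ((norm (grad (L w) x))\<^sup>2) \<partial>M) \<le> ennreal (C\<^sub>0 + C\<^sub>1 * (norm x)\<^sup>2)"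
begin

lemma measurable_L [measurable]: "(\<lambda>w. L w x) \<in> borel_measurable M"
  using integrable_L by (rule borel_measurable_integrable)

lemma measurable_grad: "(\<lambda>(w, x). grad (L w) x) \<in> borel_measurable (M \<Otimes>\<^sub>M borel)"
  by (rule borel_measurable_grad) (auto simp: differentiable_L)

lemma measurable_grad_compose [measurable (raw)]:
  assumes [measurable]: "f \<in> N \<rightarrow>\<^sub>M M" "h \<in> borel_measurable N"
  shows "(\<lambda>z. grad (L (f z)) (h z)) \<in> borel_measurable N"
proof -
  have "(\<lambda>z. (f z, h z)) \<in> N \<rightarrow>\<^sub>M M \<Otimes>\<^sub>M borel" by measurable
  from measurable_compose[OF this measurable_grad] show ?thesis by simp
qed

lemma growth_const_nonneg: "0 \<le> C\<^sub>0 + C\<^sub>1 * (norm x)\<^sup>2"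
  using C\<^sub>0_nonneg C\<^sub>1_nonneg by simp

text \<open>The squared increment along the segment is at most the integral of the squared
  directional derivative. After exchanging the integrals over \<open>t\<close> and \<open>w\<close>,
  the growth condition applies at each point of the segment, giving a bound independent of
  \<open>s\<close>.\<close>

lemma difference_quotient_L2_bound:
  assumes "0 < s" "s \<le> 1"
  shows "(\<integral>\<^sup>+ w. ennreal (((1 / s) * (L w (x + s *\<^sub>R v) - L w x))\<^sup>2) \<partial>M)
    \<le> ennreal ((norm v)\<^sup>2 * (C\<^sub>0 + C\<^sub>1 * (norm x + norm v)\<^sup>2))"
proof -
  interpret pair_sigma_finite lborel M ..
  \<comment> \<open>The segment from \<open>x\<close> to \<open>x + s *\<^sub>R v\<close> is
    parametrised by the unit interval; the prefactor \<open>1 / s\<close> then cancels the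
    \<open>s\<close> produced by the chain rule.\<close>
  define y where "y t = x + t *\<^sub>R (s *\<^sub>R v)" for t
  have [measurable]: "y \<in> borel_measurable borel" unfolding y_def by measurable
  have pointwise: "ennreal (((1 / s) * (L w (x + s *\<^sub>R v) - L w x))\<^sup>2)
      \<le> (\<integral>\<^sup>+ t\<in>{0..1}. ennreal ((norm v)\<^sup>2) * ennreal ((norm (grad (L w) (y t)))\<^sup>2) \<partial>lborel)"
    if w: "w \<in> space M" for w
  proof -
    have [measurable]: "(\<lambda>t. grad (L w) (y t)) \<in> borel_measurable borel"
      using w by (intro measurable_grad_compose) auto
    have "((\<lambda>t. (1 / s) * L w (y t)) has_real_derivative (1 / s) * (grad (L w) (y t) \<bullet> (s *\<^sub>R v)))
        (at t within {0..1})" for t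
      unfolding y_def by (intro DERIV_cmult has_real_derivative_along_line differentiable_L w)
    then have "((\<lambda>t. (1 / s) * L w (y t)) has_real_derivative (grad (L w) (y t) \<bullet> v))
        (at t within {0..1})" for t
      using \<open>0 < s\<close> by simp
    from increment_power2_le_nn_integral[OF this]
    have "ennreal (((1 / s) * L w (y 1) - (1 / s) * L w (y 0))\<^sup>2)
        \<le> (\<integral>\<^sup>+ t\<in>{0..1}. ennreal ((grad (L w) (y t) \<bullet> v)\<^sup>2) \<partial>lborel)"
      by simp
    also have "\<dots> \<le> (\<integral>\<^sup>+ t\<in>{0..1}. ennreal ((norm v)\<^sup>2) * ennreal ((norm (grad (L w) (y t)))\<^sup>2) \<partial>lborel)"
    proof (intro nn_integral_mono mult_right_mono)
      fix t
      have "(grad (L w) (y t) \<bullet> v)\<^sup>2 \<le> (norm (grad (L w) (y t)) * norm v)\<^sup>2"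
        by (rule power2_le_iff_abs_le[THEN iffD2]) (auto simp: Cauchy_Schwarz_ineq2)
      then show "ennreal ((grad (L w) (y t) \<bullet> v)\<^sup>2)
          \<le> ennreal ((norm v)\<^sup>2) * ennreal ((norm (grad (L w) (y t)))\<^sup>2)"
        by (simp add: power_mult_distrib mult.commute flip: ennreal_mult)
    qed auto
    finally show ?thesis by (simp add: y_def right_diff_distrib)
  qed
  have "(\<integral>\<^sup>+ w. ennreal (((1 / s) * (L w (x + s *\<^sub>R v) - L w x))\<^sup>2) \<partial>M)
      \<le> (\<integral>\<^sup>+ w. (\<integral>\<^sup>+ t\<in>{0..1}. ennreal ((norm v)\<^sup>2) * ennreal ((norm (grad (L w) (y t)))\<^sup>2) \<partial>lborel) \<partial>M)"
    by (intro nn_integral_mono pointwise)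
  also have "\<dots> = (\<integral>\<^sup>+ t. (\<integral>\<^sup>+ w. ennreal ((norm v)\<^sup>2) * ennreal ((norm (grad (L w) (y t)))\<^sup>2)
      * indicator {0..1} t \<partial>M) \<partial>lborel)"
    by (rule Fubini') measurable
  also have "\<dots> \<le> (\<integral>\<^sup>+ t. ennreal ((norm v)\<^sup>2 * (C\<^sub>0 + C\<^sub>1 * (norm x + norm v)\<^sup>2)) * indicator {0..1::real} t \<partial>lborel)"
  proof (rule nn_integral_mono)
    fix t :: real
    show "(\<integral>\<^sup>+ w. ennreal ((norm v)\<^sup>2) * ennreal ((norm (grad (L w) (y t)))\<^sup>2) * indicator {0..1} t \<partial>M)
      \<le> ennreal ((norm v)\<^sup>2 * (C\<^sub>0 + C\<^sub>1 * (norm x + norm v)\<^sup>2)) * indicator {0..1} t"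
    proof (cases "t \<in> {0..1}")
      case True
      have "norm (y t) \<le> norm x + \<bar>t * s\<bar> * norm v"
        unfolding y_def using norm_triangle_ineq[of x "(t * s) *\<^sub>R v"] by simp
      also have "\<dots> \<le> norm x + 1 * norm v"
        using True assms by (intro add_left_mono mult_right_mono) (auto simp: mult_le_one)
      finally have "(norm (y t))\<^sup>2 \<le> (norm x + norm v)\<^sup>2" by (intro power_mono) auto
      then have "(\<integral>\<^sup>+ w. ennreal ((norm (grad (L w) (y t)))\<^sup>2) \<partial>M) \<le> ennreal (C\<^sub>0 + C\<^sub>1 * (norm x + norm v)\<^sup>2)"
        by (intro order_trans[OF growth] ennreal_leI add_left_mono mult_left_mono C\<^sub>1_nonneg)
      then have "ennreal ((norm v)\<^sup>2) * (\<integral>\<^sup>+ w. ennreal ((norm (grad (L w) (y t)))\<^sup>2) \<partial>M)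
          \<le> ennreal ((norm v)\<^sup>2 * (C\<^sub>0 + C\<^sub>1 * (norm x + norm v)\<^sup>2))"
        using C\<^sub>0_nonneg C\<^sub>1_nonneg by (simp add: ennreal_mult mult_left_mono)
      then show ?thesis using True by (simp add: nn_integral_cmult)
    qed simp
  qed
  also have "\<dots> = ennreal ((norm v)\<^sup>2 * (C\<^sub>0 + C\<^sub>1 * (norm x + norm v)\<^sup>2))"
    by (subst nn_integral_cmult_indicator) auto
  finally show ?thesis .
qed

lemma square_integrable_grad:
  "integrable M (\<lambda>w. (norm (grad (L w) x))\<^sup>2)"
  "(\<integral>w. (norm (grad (L w) x))\<^sup>2 \<partial>M) \<le> C\<^sub>0 + C\<^sub>1 * (norm x)\<^sup>2"
proof -
  have "(\<lambda>w. norm (grad (L w) x)) \<in> borel_measurable M" by measurable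
  from square_integrableI[OF this growth growth_const_nonneg]
  show "integrable M (\<lambda>w. (norm (grad (L w) x))\<^sup>2)"
    "(\<integral>w. (norm (grad (L w) x))\<^sup>2 \<partial>M) \<le> C\<^sub>0 + C\<^sub>1 * (norm x)\<^sup>2" by blast+
qed

lemma grad_inner_L2_bound:
  "(\<integral>\<^sup>+ w. ennreal ((grad (L w) x \<bullet> v)\<^sup>2) \<partial>M) \<le> ennreal ((norm v)\<^sup>2 * (C\<^sub>0 + C\<^sub>1 * (norm x)\<^sup>2))"
proof -
  have "(\<integral>\<^sup>+ w. ennreal ((grad (L w) x \<bullet> v)\<^sup>2) \<partial>M)
      \<le> (\<integral>\<^sup>+ w. ennreal ((norm v)\<^sup>2) * ennreal ((norm (grad (L w) x))\<^sup>2) \<partial>M)"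
  proof (intro nn_integral_mono)
    fix w
    have "(grad (L w) x \<bullet> v)\<^sup>2 \<le> (norm (grad (L w) x) * norm v)\<^sup>2"
      by (rule power2_le_iff_abs_le[THEN iffD2]) (auto simp: Cauchy_Schwarz_ineq2)
    then show "ennreal ((grad (L w) x \<bullet> v)\<^sup>2) \<le> ennreal ((norm v)\<^sup>2) * ennreal ((norm (grad (L w) x))\<^sup>2)"
      by (simp add: power_mult_distrib mult.commute flip: ennreal_mult)
  qed
  also have "\<dots> = ennreal ((norm v)\<^sup>2) * (\<integral>\<^sup>+ w. ennreal ((norm (grad (L w) x))\<^sup>2) \<partial>M)"
    by (rule nn_integral_cmult) measurable
  also have "\<dots> \<le> ennreal ((norm v)\<^sup>2 * (C\<^sub>0 + C\<^sub>1 * (norm x)\<^sup>2))"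
    using growth[of x] growth_const_nonneg[of x] by (simp add: ennreal_mult mult_left_mono)
  finally show ?thesis .
qed

lemma integrable_grad_inner: "integrable M (\<lambda>w. grad (L w) x \<bullet> v)"
proof (rule square_integrableI(2)[OF _ grad_inner_L2_bound])
  show "(\<lambda>w. grad (L w) x \<bullet> v) \<in> borel_measurable M" by measurable
  show "0 \<le> (norm v)\<^sup>2 * (C\<^sub>0 + C\<^sub>1 * (norm x)\<^sup>2)" using growth_const_nonneg[of x] by simp
qed

text \<open>The quotients converge pointwise and are bounded in mean square uniformly in
  \<open>n\<close>, so their means converge. A one-sided limit along a sequence suffices for
  comparison with the convexity inequality.\<close>

lemma expected_loss_difference_quotient_LIMSEQ:
  "(\<lambda>n. real (Suc n) * (expected_loss M L (x + (1 / real (Suc n)) *\<^sub>R v) - expected_loss M L x))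
    \<longlonglongrightarrow> (\<integral>w. grad (L w) x \<bullet> v \<partial>M)"
proof -
  \<comment> \<open>One constant must serve both the quotients and their limit;
    \<open>norm x + norm v\<close> bounds every point reached by a step of length at most 1 along
    \<open>v\<close>.\<close>
  define K where "K = (norm v)\<^sup>2 * (C\<^sub>0 + C\<^sub>1 * (norm x + norm v)\<^sup>2)"
  have K: "0 \<le> K" "(norm v)\<^sup>2 * (C\<^sub>0 + C\<^sub>1 * (norm x)\<^sup>2) \<le> K"
    unfolding K_def using C\<^sub>0_nonneg C\<^sub>1_nonneg
    by (auto intro!: mult_left_mono add_left_mono power_mono)
  have "(\<lambda>n. \<integral>w. real (Suc n) * (L w (x + (1 / real (Suc n)) *\<^sub>R v) - L w x) \<partial>M)
      \<longlonglongrightarrow> (\<integral>w. grad (L w) x \<bullet> v \<partial>M)"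
  proof (rule integral_LIMSEQ_L2_bounded[OF _ _ _ _ _ K(1)])
    show "AE w in M. (\<lambda>n. real (Suc n) * (L w (x + (1 / real (Suc n)) *\<^sub>R v) - L w x))
        \<longlonglongrightarrow> grad (L w) x \<bullet> v"
      by (intro AE_I2 difference_quotient_LIMSEQ differentiable_L)
    show "(\<integral>\<^sup>+ w. ennreal ((real (Suc n) * (L w (x + (1 / real (Suc n)) *\<^sub>R v) - L w x))\<^sup>2) \<partial>M) \<le> ennreal K" for n
      using difference_quotient_L2_bound[of "1 / real (Suc n)" x v] unfolding K_def by simp
    show "(\<integral>\<^sup>+ w. ennreal ((grad (L w) x \<bullet> v)\<^sup>2) \<partial>M) \<le> ennreal K"
      by (rule order_trans[OF grad_inner_L2_bound ennreal_leI[OF K(2)]])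
  next
    show "(\<lambda>w. real (Suc n) * (L w (x + (1 / real (Suc n)) *\<^sub>R v) - L w x)) \<in> borel_measurable M" for n
      by (intro borel_measurable_times borel_measurable_diff measurable_L) simp
    show "(\<lambda>w. grad (L w) x \<bullet> v) \<in> borel_measurable M"
      by measurable
  qed
  moreover have "(\<integral>w. real (Suc n) * (L w (x + (1 / real (Suc n)) *\<^sub>R v) - L w x) \<partial>M)
      = real (Suc n) * (expected_loss M L (x + (1 / real (Suc n)) *\<^sub>R v) - expected_loss M L x)" for n
    unfolding expected_loss_def
    by (simp only: integral_mult_right_zero Bochner_Integration.integral_diff[OF integrable_L integrable_L])
  ultimately show ?thesis by (simp only:)
qed

text \<open>Convexity at \<open>x\<close> is used twice. At points displaced from \<open>x\<close>
  away from \<open>x\<^sub>0\<close> it bounds the difference quotients, and so their limit, from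
  below by \<open>g \<bullet> (x - x\<^sub>0)\<close>; at \<open>x\<^sub>0\<close> itself,
  minimality turns it into the quadratic lower bound for this product. Thus \<open>g\<close> need
  not be identified with the mean gradient.\<close>

lemma expected_grad_inner_ge:
  assumes subgradient: "\<And>Y. expected_loss M L Y \<ge> expected_loss M L x + g \<bullet> (Y - x) + \<mu> / 2 * (norm (x - Y))\<^sup>2"
    and "0 \<le> \<mu>" and min: "expected_loss M L x\<^sub>0 \<le> expected_loss M L x"
  shows "\<mu> / 2 * (norm (x - x\<^sub>0))\<^sup>2 \<le> (\<integral>w. grad (L w) x \<bullet> (x - x\<^sub>0) \<partial>M)"
proof -
  have "g \<bullet> (x - x\<^sub>0) \<le> real (Suc n) * (expected_loss M L (x + (1 / real (Suc n)) *\<^sub>R (x - x\<^sub>0)) - expected_loss M L x)" for n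
  proof -
    define s where "s = 1 / real (Suc n)"
    have s: "real (Suc n) * s = 1" unfolding s_def by simp
    have "0 \<le> \<mu> / 2 * (norm (x - (x + s *\<^sub>R (x - x\<^sub>0))))\<^sup>2" using \<open>0 \<le> \<mu>\<close> by simp
    then have "s * (g \<bullet> (x - x\<^sub>0)) \<le> expected_loss M L (x + s *\<^sub>R (x - x\<^sub>0)) - expected_loss M L x"
      using subgradient[of "x + s *\<^sub>R (x - x\<^sub>0)"] by simp
    from mult_left_mono[OF this, of "real (Suc n)"] show ?thesis
      unfolding mult.assoc[symmetric] s unfolding s_def by simp
  qed
  then have "g \<bullet> (x - x\<^sub>0) \<le> (\<integral>w. grad (L w) x \<bullet> (x - x\<^sub>0) \<partial>M)"
    by (intro LIMSEQ_le_const[OF expected_loss_difference_quotient_LIMSEQ]) blast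
  moreover have "\<mu> / 2 * (norm (x - x\<^sub>0))\<^sup>2 \<le> g \<bullet> (x - x\<^sub>0)"
    using subgradient[of x\<^sub>0] min by (simp add: inner_diff_right)
  ultimately show ?thesis by linarith
qed

text \<open>After expanding the square, \<open>expected_grad_inner_ge\<close> controls the cross
  term and growth the last one. Recentring the growth bound by \<open>(norm x)\<^sup>2 \<le> 2 *
  (norm (x - x\<^sub>0))\<^sup>2 + 2 * (norm x\<^sub>0)\<^sup>2\<close> produces the factors 2 in
  \<open>B\<close>.\<close>

lemma gradient_step_mean_square_le:
  assumes subgradient: "\<And>Y. expected_loss M L Y \<ge> expected_loss M L x + g \<bullet> (Y - x) + \<mu> / 2 * (norm (x - Y))\<^sup>2"
    and "0 \<le> \<mu>" and min: "expected_loss M L x\<^sub>0 \<le> expected_loss M L x" and "0 \<le> r"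
  defines "B \<equiv> (1 - r * \<mu> + r\<^sup>2 * (2 * C\<^sub>1)) * (norm (x - x\<^sub>0))\<^sup>2 + r\<^sup>2 * (C\<^sub>0 + 2 * C\<^sub>1 * (norm x\<^sub>0)\<^sup>2)"
  shows "(\<integral>\<^sup>+ w. ennreal ((norm (x - r *\<^sub>R grad (L w) x - x\<^sub>0))\<^sup>2) \<partial>M) \<le> ennreal B" "0 \<le> B"
proof -
  let ?G = "\<lambda>w. grad (L w) x"
  have expand: "(norm (x - r *\<^sub>R G - x\<^sub>0))\<^sup>2 = (norm (x - x\<^sub>0))\<^sup>2 - 2 * r * (G \<bullet> (x - x\<^sub>0)) + r\<^sup>2 * (norm G)\<^sup>2" for G
  proof -
    have "(norm (u - r *\<^sub>R G))\<^sup>2 = (norm u)\<^sup>2 - 2 * r * (G \<bullet> u) + r\<^sup>2 * (norm G)\<^sup>2" for u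
      unfolding power2_norm_eq_inner inner_diff_left inner_diff_right
      by (simp add: inner_commute power2_eq_square)
    from this[of "x - x\<^sub>0"] show ?thesis by (simp add: algebra_simps)
  qed
  have int: "integrable M (\<lambda>w. (norm (x - r *\<^sub>R ?G w - x\<^sub>0))\<^sup>2)"
    unfolding expand using square_integrable_grad(1) integrable_grad_inner by simp
  have "(\<integral>w. (norm (x - r *\<^sub>R ?G w - x\<^sub>0))\<^sup>2 \<partial>M)
      = (norm (x - x\<^sub>0))\<^sup>2 - 2 * r * (\<integral>w. ?G w \<bullet> (x - x\<^sub>0) \<partial>M) + r\<^sup>2 * (\<integral>w. (norm (?G w))\<^sup>2 \<partial>M)"
    unfolding expand using square_integrable_grad(1) integrable_grad_inner by (simp add: prob_space)
  also have "\<dots> \<le> B"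
  proof -
    have "2 * r * (\<mu> / 2 * (norm (x - x\<^sub>0))\<^sup>2) \<le> 2 * r * (\<integral>w. ?G w \<bullet> (x - x\<^sub>0) \<partial>M)"
      using expected_grad_inner_ge[OF subgradient \<open>0 \<le> \<mu>\<close> min] \<open>0 \<le> r\<close> by (intro mult_left_mono) auto
    moreover have "r\<^sup>2 * (\<integral>w. (norm (?G w))\<^sup>2 \<partial>M)
        \<le> r\<^sup>2 * (C\<^sub>0 + C\<^sub>1 * (2 * (norm (x - x\<^sub>0))\<^sup>2 + 2 * (norm x\<^sub>0)\<^sup>2))"
    proof (rule mult_left_mono)
      have "norm x \<le> norm (x - x\<^sub>0) + norm x\<^sub>0" using norm_triangle_ineq[of "x - x\<^sub>0" x\<^sub>0] by simp
      then have "(norm x)\<^sup>2 \<le> (norm (x - x\<^sub>0) + norm x\<^sub>0)\<^sup>2" by (intro power_mono) auto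
      also have "\<dots> \<le> 2 * (norm (x - x\<^sub>0))\<^sup>2 + 2 * (norm x\<^sub>0)\<^sup>2"
        using zero_le_power2[of "norm (x - x\<^sub>0) - norm x\<^sub>0"] by (simp add: power2_sum power2_diff)
      finally have "C\<^sub>0 + C\<^sub>1 * (norm x)\<^sup>2 \<le> C\<^sub>0 + C\<^sub>1 * (2 * (norm (x - x\<^sub>0))\<^sup>2 + 2 * (norm x\<^sub>0)\<^sup>2)"
        by (intro add_left_mono mult_left_mono C\<^sub>1_nonneg)
      then show "(\<integral>w. (norm (?G w))\<^sup>2 \<partial>M) \<le> C\<^sub>0 + C\<^sub>1 * (2 * (norm (x - x\<^sub>0))\<^sup>2 + 2 * (norm x\<^sub>0)\<^sup>2)"
        using square_integrable_grad(2)[of x] by linarith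
    qed simp
    moreover have "B = (norm (x - x\<^sub>0))\<^sup>2 - 2 * r * (\<mu> / 2 * (norm (x - x\<^sub>0))\<^sup>2)
        + r\<^sup>2 * (C\<^sub>0 + C\<^sub>1 * (2 * (norm (x - x\<^sub>0))\<^sup>2 + 2 * (norm x\<^sub>0)\<^sup>2))"
      unfolding B_def by (simp add: algebra_simps)
    ultimately show ?thesis by linarith
  qed
  finally have le: "(\<integral>w. (norm (x - r *\<^sub>R ?G w - x\<^sub>0))\<^sup>2 \<partial>M) \<le> B" .
  then show "(\<integral>\<^sup>+ w. ennreal ((norm (x - r *\<^sub>R ?G w - x\<^sub>0))\<^sup>2) \<partial>M) \<le> ennreal B"
    using nn_integral_eq_integral[OF int] by (simp add: ennreal_leI)
  \<comment> \<open>Not visible in the formula for \<open>B\<close>: it follows because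
    \<open>B\<close> dominates the mean of a square.\<close>
  show "0 \<le> B" using le by (rule order_trans[rotated]) simp
qed

end

subsection \<open>The mean square recursion\<close>

text \<open>Each sample has law \<open>M\<close>, so it almost surely avoids the null set where the
  two losses differ.\<close>

lemma sgd_iterates_cong_AE:
  assumes sgd: "sgd_iterates M L \<rho> P \<omega> X" and eq: "AE w in M. L w = L' w"
  shows "sgd_iterates M L' \<rho> P \<omega> X"
proof -
  have "AE z in P. X (Suc n) z = X n z - \<rho> n *\<^sub>R grad (L' (\<omega> n z)) (X n z)" for n
  proof -
    have \<omega>: "\<omega> n \<in> P \<rightarrow>\<^sub>M M" and law: "distr P M (\<omega> n) = M"
      using sgd by (auto simp: sgd_iterates_def)
    have "AE w in distr P M (\<omega> n). L w = L' w" unfolding law by (rule eq)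
    with \<omega> have "AE z in P. L (\<omega> n z) = L' (\<omega> n z)" by (rule AE_distrD)
    moreover have "AE z in P. X (Suc n) z = X n z - \<rho> n *\<^sub>R grad (L (\<omega> n z)) (X n z)"
      using sgd by (simp add: sgd_iterates_def)
    ultimately show ?thesis by eventually_elim simp
  qed
  then show ?thesis using sgd by (simp add: sgd_iterates_def)
qed

text \<open>The first sigma-algebra in the independence clause of \<open>sgd_iterates\<close>: the
  information available before sample \<open>n\<close> is drawn. As a measure space it can serve as
  the source of measurable maps.\<close>

definition past_algebra :: "'w measure \<Rightarrow> 'z measure \<Rightarrow> (nat \<Rightarrow> 'z \<Rightarrow> 'w) \<Rightarrow> ('z \<Rightarrow> 'a::topological_space) \<Rightarrow> nat \<Rightarrow> 'z measure"
  where "past_algebra M P \<omega> X\<^sub>0 n = vimage_algebra (space P) (\<lambda>z. (X\<^sub>0 z, \<lambda>i\<in>{..<n}. \<omega> i z))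
    (borel \<Otimes>\<^sub>M (\<Pi>\<^sub>M i\<in>{..<n}. M))"

lemma space_past_algebra [simp]: "space (past_algebra M P \<omega> X\<^sub>0 n) = space P"
  by (simp add: past_algebra_def)

lemma measurable_past_algebra:
  assumes \<omega>: "\<And>i. \<omega> i \<in> P \<rightarrow>\<^sub>M M"
  shows "X\<^sub>0 \<in> past_algebra M P \<omega> X\<^sub>0 n \<rightarrow>\<^sub>M borel" (is ?init)
    and "i < n \<Longrightarrow> \<omega> i \<in> past_algebra M P \<omega> X\<^sub>0 n \<rightarrow>\<^sub>M M"
proof -
  have T: "(\<lambda>z. (X\<^sub>0 z, \<lambda>i\<in>{..<n}. \<omega> i z)) \<in> past_algebra M P \<omega> X\<^sub>0 n \<rightarrow>\<^sub>M borel \<Otimes>\<^sub>M (\<Pi>\<^sub>M i\<in>{..<n}. M)"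
    unfolding past_algebra_def
    by (rule measurable_vimage_algebra1)
       (auto simp: space_pair_measure space_PiM PiE_iff measurable_space[OF \<omega>])
  from measurable_compose[OF T measurable_fst] show ?init by simp
  assume "i < n"
  then have "(\<lambda>p. snd p i) \<in> borel \<Otimes>\<^sub>M (\<Pi>\<^sub>M i\<in>{..<n}. M) \<rightarrow>\<^sub>M M"
    by (intro measurable_compose[OF measurable_snd measurable_component_singleton]) auto
  from measurable_compose[OF T this] \<open>i < n\<close>
  show "\<omega> i \<in> past_algebra M P \<omega> X\<^sub>0 n \<rightarrow>\<^sub>M M" by simp
qed

text \<open>The past algebras form a filtration: the shorter tuple of samples is measurable for the
  longer past, so the identity map is measurable between the two.\<close>

lemma measurable_past_algebra_Suc:
  assumes \<omega>: "\<And>i. \<omega> i \<in> P \<rightarrow>\<^sub>M M" and Y: "Y \<in> past_algebra M P \<omega> X\<^sub>0 n \<rightarrow>\<^sub>M N"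
  shows "Y \<in> past_algebra M P \<omega> X\<^sub>0 (Suc n) \<rightarrow>\<^sub>M N"
proof -
  have "(\<lambda>z. z) \<in> past_algebra M P \<omega> X\<^sub>0 (Suc n) \<rightarrow>\<^sub>M past_algebra M P \<omega> X\<^sub>0 n"
    unfolding past_algebra_def[of _ _ _ _ n]
  proof (rule measurable_vimage_algebra2)
    show "(\<lambda>z. (X\<^sub>0 z, \<lambda>i\<in>{..<n}. \<omega> i z)) \<in> past_algebra M P \<omega> X\<^sub>0 (Suc n) \<rightarrow>\<^sub>M borel \<Otimes>\<^sub>M (\<Pi>\<^sub>M i\<in>{..<n}. M)"
      by (intro measurable_Pair measurable_restrict measurable_past_algebra \<omega>) auto
  qed simp
  from measurable_compose[OF this Y] show ?thesis by simp
qed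

text \<open>
  The recursion holds only almost surely, so \<open>X n\<close> itself need not be measurable with
  respect to the algebra of the past.
\<close>

lemma sgd_iterates_AE_eq_past_measurable:
  fixes L :: "'w \<Rightarrow> real ^ 'n \<Rightarrow> real"
  assumes loss: "differentiable_loss M L C\<^sub>0 C\<^sub>1" and sgd: "sgd_iterates M L \<rho> P \<omega> X"
  shows "\<exists>Y. Y \<in> past_algebra M P \<omega> (X 0) n \<rightarrow>\<^sub>M borel \<and> (AE z in P. X n z = Y z)"
proof -
  interpret differentiable_loss M L C\<^sub>0 C\<^sub>1 by fact
  have \<omega>: "\<And>i. \<omega> i \<in> P \<rightarrow>\<^sub>M M" using sgd by (simp add: sgd_iterates_def)
  show ?thesis
  proof (induction n)
    case 0
    have "X 0 \<in> past_algebra M P \<omega> (X 0) 0 \<rightarrow>\<^sub>M borel"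
      by (rule measurable_past_algebra(1)) (rule \<omega>)
    then show ?case by blast
  next
    case (Suc n)
    then obtain Y where Y: "Y \<in> past_algebra M P \<omega> (X 0) n \<rightarrow>\<^sub>M borel" "AE z in P. X n z = Y z"
      by blast
    \<comment> \<open>The update uses \<open>\<omega> n\<close>, which enters the past only at
      \<open>Suc n\<close>.\<close>
    have [measurable]: "Y \<in> past_algebra M P \<omega> (X 0) (Suc n) \<rightarrow>\<^sub>M borel"
      "\<omega> n \<in> past_algebra M P \<omega> (X 0) (Suc n) \<rightarrow>\<^sub>M M"
      by (auto intro: measurable_past_algebra_Suc measurable_past_algebra(2) \<omega> Y(1))
    have "AE z in P. X (Suc n) z = X n z - \<rho> n *\<^sub>R grad (L (\<omega> n z)) (X n z)"
      using sgd by (simp add: sgd_iterates_def)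
    with Y(2) have "AE z in P. X (Suc n) z = Y z - \<rho> n *\<^sub>R grad (L (\<omega> n z)) (Y z)"
      by eventually_elim simp
    moreover have "(\<lambda>z. Y z - \<rho> n *\<^sub>R grad (L (\<omega> n z)) (Y z)) \<in> past_algebra M P \<omega> (X 0) (Suc n) \<rightarrow>\<^sub>M borel"
      by measurable
    ultimately show ?case by blast
  qed
qed

text \<open>A past-measurable version \<open>Y\<close> of \<open>X n\<close> makes the law of
  \<open>(Y, \<omega> n)\<close> a product. Tonelli then permits integrating over the fresh sample
  with the iterate frozen, where \<open>gradient_step_mean_square_le\<close> applies, and averaging
  the resulting bound.\<close>

lemma sgd_iterates_step:
  fixes L :: "'w \<Rightarrow> real ^ 'n \<Rightarrow> real"
  assumes loss: "differentiable_loss M L C\<^sub>0 C\<^sub>1" and sgd: "sgd_iterates M L \<rho> P \<omega> X"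
    and subgradient: "\<And>x y. expected_loss M L y \<ge> expected_loss M L x + g x \<bullet> (y - x) + \<mu> / 2 * (norm (x - y))\<^sup>2"
    and "0 \<le> \<mu>" and min: "\<And>y. expected_loss M L x\<^sub>0 \<le> expected_loss M L y"
    and int: "integrable P (\<lambda>z. (norm (X n z - x\<^sub>0))\<^sup>2)"
  defines "B \<equiv> (1 - \<rho> n * \<mu> + (\<rho> n)\<^sup>2 * (2 * C\<^sub>1)) * mean_sq_dist P (X n) x\<^sub>0
      + (\<rho> n)\<^sup>2 * (C\<^sub>0 + 2 * C\<^sub>1 * (norm x\<^sub>0)\<^sup>2)"
  shows "integrable P (\<lambda>z. (norm (X (Suc n) z - x\<^sub>0))\<^sup>2)" "mean_sq_dist P (X (Suc n)) x\<^sub>0 \<le> B"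
proof -
  interpret differentiable_loss M L C\<^sub>0 C\<^sub>1 by fact
  interpret P: prob_space P using sgd by (simp add: sgd_iterates_def)
  have [measurable]: "\<And>n. X n \<in> borel_measurable P" and \<omega> [measurable]: "\<And>i. \<omega> i \<in> P \<rightarrow>\<^sub>M M"
    and law: "distr P M (\<omega> n) = M" and \<rho>: "0 \<le> \<rho> n"
    and rec: "AE z in P. X (Suc n) z = X n z - \<rho> n *\<^sub>R grad (L (\<omega> n z)) (X n z)"
    and indep: "P.indep_set (sets (past_algebra M P \<omega> (X 0) n)) (sets (vimage_algebra (space P) (\<omega> n) M))"
    using sgd by (auto simp: sgd_iterates_def past_algebra_def less_imp_le)
  obtain Y where Y: "Y \<in> past_algebra M P \<omega> (X 0) n \<rightarrow>\<^sub>M borel" and X_eq_Y: "AE z in P. X n z = Y z"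
    using sgd_iterates_AE_eq_past_measurable[OF loss sgd] by blast
  have [measurable]: "Y \<in> borel_measurable P"
    using indep measurable_sets[OF Y] by (auto intro!: measurableI simp: P.indep_sets2_eq)
  have joint: "distr P (borel \<Otimes>\<^sub>M M) (\<lambda>z. (Y z, \<omega> n z)) = distr P borel Y \<Otimes>\<^sub>M M"
    using P.distr_pair_eq_pair_measure[OF space_past_algebra Y \<omega> indep] unfolding law .
  define b where "b x = (1 - \<rho> n * \<mu> + (\<rho> n)\<^sup>2 * (2 * C\<^sub>1)) * (norm (x - x\<^sub>0))\<^sup>2
      + (\<rho> n)\<^sup>2 * (C\<^sub>0 + 2 * C\<^sub>1 * (norm x\<^sub>0)\<^sup>2)" for x
  have [measurable]: "b \<in> borel_measurable borel" unfolding b_def by measurable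
  have step: "(\<integral>\<^sup>+ w. ennreal ((norm (x - \<rho> n *\<^sub>R grad (L w) x - x\<^sub>0))\<^sup>2) \<partial>M) \<le> ennreal (b x)" "0 \<le> b x" for x
    using gradient_step_mean_square_le[OF subgradient \<open>0 \<le> \<mu>\<close> min \<rho>] unfolding b_def by auto
  define F where "F p = ennreal ((norm (fst p - \<rho> n *\<^sub>R grad (L (snd p)) (fst p) - x\<^sub>0))\<^sup>2)" for p
  have [measurable]: "F \<in> borel_measurable (borel \<Otimes>\<^sub>M M)" unfolding F_def by measurable
  have [measurable]: "F \<in> borel_measurable (distr P borel Y \<Otimes>\<^sub>M M)" by measurable
  have "(\<integral>\<^sup>+ z. ennreal ((norm (X (Suc n) z - x\<^sub>0))\<^sup>2) \<partial>P) = (\<integral>\<^sup>+ z. F (Y z, \<omega> n z) \<partial>P)"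
    by (rule nn_integral_cong_AE) (use rec X_eq_Y in \<open>eventually_elim, simp add: F_def\<close>)
  also have "\<dots> = (\<integral>\<^sup>+ p. F p \<partial>distr P (borel \<Otimes>\<^sub>M M) (\<lambda>z. (Y z, \<omega> n z)))"
    by (rule nn_integral_distr[symmetric]) measurable
  also have "\<dots> = (\<integral>\<^sup>+ x. (\<integral>\<^sup>+ w. F (x, w) \<partial>M) \<partial>distr P borel Y)"
    unfolding joint by (rule nn_integral_fst[symmetric]) measurable
  also have "\<dots> \<le> (\<integral>\<^sup>+ x. ennreal (b x) \<partial>distr P borel Y)"
    unfolding F_def fst_conv snd_conv by (intro nn_integral_mono step)
  also have "\<dots> = (\<integral>\<^sup>+ z. ennreal (b (Y z)) \<partial>P)"
    by (rule nn_integral_distr) measurable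
  \<comment> \<open>Back from the version \<open>Y\<close> to \<open>X n\<close>, for which
    integrability is assumed.\<close>
  also have "\<dots> = (\<integral>\<^sup>+ z. ennreal (b (X n z)) \<partial>P)"
    by (rule nn_integral_cong_AE) (use X_eq_Y in \<open>eventually_elim, simp\<close>)
  also have "\<dots> = ennreal (\<integral>z. b (X n z) \<partial>P)"
    by (rule nn_integral_eq_integral) (use int step(2) in \<open>auto simp: b_def\<close>)
  also have "(\<integral>z. b (X n z) \<partial>P) = B"
    unfolding b_def B_def mean_sq_dist_def using int by (simp add: P.prob_space)
  finally have le: "(\<integral>\<^sup>+ z. ennreal ((norm (X (Suc n) z - x\<^sub>0))\<^sup>2) \<partial>P) \<le> ennreal B" .
  \<comment> \<open>A bound by \<open>ennreal B\<close> gives a real bound by \<open>B\<close> only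
    if \<open>B\<close> is nonnegative; here \<open>B\<close> is the mean of the nonnegative
    \<open>b\<close>.\<close>
  have "0 \<le> (\<integral>z. b (X n z) \<partial>P)" using step(2) by (intro integral_nonneg_AE) simp
  then have "0 \<le> B"
    unfolding b_def B_def mean_sq_dist_def using int by (simp add: P.prob_space)
  have "(\<lambda>z. norm (X (Suc n) z - x\<^sub>0)) \<in> borel_measurable P" by measurable
  from P.square_integrableI[OF this le \<open>0 \<le> B\<close>]
  show "integrable P (\<lambda>z. (norm (X (Suc n) z - x\<^sub>0))\<^sup>2)" "mean_sq_dist P (X (Suc n)) x\<^sub>0 \<le> B"
    unfolding mean_sq_dist_def by blast+
qed

text \<open>\<open>mean_sq_dist\<close> is 0 by convention when the square is not integrable, so
  finiteness of second moments must be carried along the iteration.\<close>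

lemma sgd_iterates_square_integrable:
  fixes L :: "'w \<Rightarrow> real ^ 'n \<Rightarrow> real"
  assumes loss: "differentiable_loss M L C\<^sub>0 C\<^sub>1" and sgd: "sgd_iterates M L \<rho> P \<omega> X"
    and subgradient: "\<And>x y. expected_loss M L y \<ge> expected_loss M L x + g x \<bullet> (y - x) + \<mu> / 2 * (norm (x - y))\<^sup>2"
    and "0 \<le> \<mu>" and min: "\<And>y. expected_loss M L x\<^sub>0 \<le> expected_loss M L y"
  shows "integrable P (\<lambda>z. (norm (X n z - x\<^sub>0))\<^sup>2)"
proof (induction n)
  case 0
  interpret P: prob_space P using sgd by (simp add: sgd_iterates_def)
  have [measurable]: "X 0 \<in> borel_measurable P" and "integrable P (\<lambda>z. (norm (X 0 z))\<^sup>2)"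
    using sgd by (auto simp: sgd_iterates_def)
  then have "integrable P (\<lambda>z. 2 * (norm (X 0 z))\<^sup>2 + 2 * (norm x\<^sub>0)\<^sup>2)" by simp
  then show ?case
  proof (rule Bochner_Integration.integrable_bound)
    have "(norm (x - x\<^sub>0))\<^sup>2 \<le> 2 * (norm x)\<^sup>2 + 2 * (norm x\<^sub>0)\<^sup>2" for x
    proof -
      have "(norm (x - x\<^sub>0))\<^sup>2 \<le> (norm x + norm x\<^sub>0)\<^sup>2" by (intro power_mono norm_triangle_ineq4) simp
      then show ?thesis
        using zero_le_power2[of "norm x - norm x\<^sub>0"] by (simp add: power2_sum power2_diff)
    qed
    then show "AE z in P. norm ((norm (X 0 z - x\<^sub>0))\<^sup>2) \<le> norm (2 * (norm (X 0 z))\<^sup>2 + 2 * (norm x\<^sub>0)\<^sup>2)"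
      by simp
  qed measurable
next
  case (Suc n)
  show ?case by (rule sgd_iterates_step(1)[OF loss sgd subgradient \<open>0 \<le> \<mu>\<close> min Suc.IH])
qed

text \<open>On a null set containing all bad samples the loss is replaced by the zero function,
  which changes neither means nor growth bounds. The expected losses agree as functions, so
  convexity and minimality transfer verbatim.\<close>

lemma ex_differentiable_loss_AE_eq:
  fixes L :: "'w \<Rightarrow> 'a::euclidean_space \<Rightarrow> real"
  assumes prob: "prob_space M" and int: "\<And>x. integrable M (\<lambda>w. L w x)"
    and diff: "AE w in M. \<forall>x. L w differentiable (at x)" and "0 \<le> C\<^sub>0" "0 \<le> C\<^sub>1"
    and growth: "\<And>x. (\<integral>\<^sup>+ w. ennreal ((norm (grad (L w) x))\<^sup>2) \<partial>M) \<le> ennreal (C\<^sub>0 + C\<^sub>1 * (norm x)\<^sup>2)"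
  obtains L' where "differentiable_loss M L' C\<^sub>0 C\<^sub>1" "AE w in M. L w = L' w"
    "expected_loss M L' = expected_loss M L"
proof -
  interpret prob_space M by fact
  \<comment> \<open>The exceptional set is enlarged to a measurable null set, so that the modified
    loss stays measurable.\<close>
  obtain N where N: "N \<in> null_sets M" "\<And>w. w \<in> space M - N \<Longrightarrow> \<forall>x. L w differentiable (at x)"
    using AE_E3[OF diff] by blast
  have [measurable]: "N \<in> sets M" using N(1) by auto
  define L' where "L' w = (if w \<in> N then (\<lambda>_. 0) else L w)" for w
  have eq: "AE w in M. L w = L' w"
    using AE_not_in[OF N(1)] by eventually_elim (simp add: L'_def)
  have [measurable]: "(\<lambda>w. L w x) \<in> borel_measurable M" for x
    using int by (rule borel_measurable_integrable)
  have "(\<lambda>w. L' w x) = (\<lambda>w. if w \<in> N then 0 else L w x)" for x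
    by (auto simp: L'_def)
  then have [measurable]: "(\<lambda>w. L' w x) \<in> borel_measurable M" for x by simp
  have eq_x: "AE w in M. L w x = L' w x" for x using eq by eventually_elim simp
  show thesis
  proof (rule that[of L'])
    show "expected_loss M L' = expected_loss M L"
      unfolding expected_loss_def
    proof
      show "(\<integral>w. L' w x \<partial>M) = (\<integral>w. L w x \<partial>M)" for x
        by (rule integral_cong_AE[symmetric, OF _ _ eq_x]) auto
    qed
    show "differentiable_loss M L' C\<^sub>0 C\<^sub>1"
    proof
      show "integrable M (\<lambda>w. L' w x)" for x
        by (rule Bochner_Integration.integrable_cong_AE[THEN iffD1, OF _ _ eq_x int]) auto
      show "L' w differentiable (at x)" if "w \<in> space M" for w x
        using N(2) that by (simp add: L'_def)
      have "(\<integral>\<^sup>+ w. ennreal ((norm (grad (L' w) x))\<^sup>2) \<partial>M) = (\<integral>\<^sup>+ w. ennreal ((norm (grad (L w) x))\<^sup>2) \<partial>M)" for x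
        by (rule nn_integral_cong_AE) (use eq in \<open>eventually_elim, simp\<close>)
      then show "(\<integral>\<^sup>+ w. ennreal ((norm (grad (L' w) x))\<^sup>2) \<partial>M) \<le> ennreal (C\<^sub>0 + C\<^sub>1 * (norm x)\<^sup>2)" for x
        using growth by simp
    qed fact+
  qed (fact eq)
qed

section \<open>Assembly: the minimum point, the recursion, and constant or vanishing learning
  rates\<close>

theorem theorem1:
  fixes M :: "'w measure"
    and L :: "'w \<Rightarrow> (real ^ 'n) \<Rightarrow> real"
    and C\<^sub>0 C\<^sub>1 \<mu> :: real
  assumes prob: "prob_space M"
    and int: "\<And>X. integrable M (\<lambda>w. L w X)"
    and diff: "AE w in M. \<forall>X. L w differentiable (at X)"
    and C_pos: "C\<^sub>0 > 0" "C\<^sub>1 > 0"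
    and growth: "\<And>X. (\<integral>\<^sup>+ w. ennreal ((norm (grad (L w) X))\<^sup>2) \<partial>M)
                    \<le> ennreal (C\<^sub>0 + C\<^sub>1 * (norm X)\<^sup>2)"
    and \<mu>_pos: "\<mu> > 0"
    and strongly_convex:
      "\<And>X Y. expected_loss M L Y \<ge> expected_loss M L X
          + grad (expected_loss M L) X \<bullet> (Y - X) + \<mu> / 2 * (norm (X - Y))\<^sup>2"
  shows
    "(\<exists>!x. \<forall>Y. expected_loss M L x \<le> expected_loss M L Y) \<and>
     (\<forall>x. (\<forall>Y. expected_loss M L x \<le> expected_loss M L Y) \<longrightarrow>
        (\<exists>c\<^sub>0>0. \<exists>c\<^sub>1>0. \<forall>\<rho> (P :: 'z measure) \<omega> X. sgd_iterates M L \<rho> P \<omega> X \<longrightarrow>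
           (\<forall>n. integrable P (\<lambda>z. (norm (X n z - x))\<^sup>2) \<and>
                mean_sq_dist P (X (Suc n)) x
                  \<le> (1 - \<rho> n * \<mu> + (\<rho> n)\<^sup>2 * c\<^sub>1) * mean_sq_dist P (X n) x + (\<rho> n)\<^sup>2 * c\<^sub>0)) \<and>
        (\<forall>\<epsilon>>0. \<exists>\<rho>\<^sub>\<epsilon>>0. \<forall>\<rho> (P :: 'z measure) \<omega> X.
           0 < \<rho> \<and> \<rho> < \<rho>\<^sub>\<epsilon> \<and> sgd_iterates M L (\<lambda>_. \<rho>) P \<omega> X \<longrightarrow>
             limsup (\<lambda>n. ereal (mean_sq_dist P (X (Suc n)) x)) \<le> ereal \<epsilon>) \<and>
        (\<forall>\<rho> (P :: 'z measure) \<omega> X.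
           sgd_iterates M L \<rho> P \<omega> X \<and> \<rho> \<longlonglongrightarrow> 0 \<and>
           filterlim (\<lambda>m. \<Sum>n=1..m. \<rho> n) at_top sequentially \<longrightarrow>
             (\<lambda>n. mean_sq_dist P (X n) x) \<longlonglongrightarrow> 0))"
proof (intro conjI allI impI)
  show "\<exists>!x. \<forall>Y. expected_loss M L x \<le> expected_loss M L Y"
    using strongly_convex \<mu>_pos by (rule strongly_convex_ex1_minimum)
next
  fix x assume min: "\<forall>Y. expected_loss M L x \<le> expected_loss M L Y"
  obtain L' where loss: "differentiable_loss M L' C\<^sub>0 C\<^sub>1" and eq: "AE w in M. L w = L' w"
    and expected: "expected_loss M L' = expected_loss M L"
    using ex_differentiable_loss_AE_eq[OF prob int diff _ _ growth] C_pos by (metis less_imp_le)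
  \<comment> \<open>The constants of \<open>sgd_iterates_step\<close> at the minimum point; they do
    not depend on the rates or on the process.\<close>
  define c\<^sub>0 where "c\<^sub>0 = C\<^sub>0 + 2 * C\<^sub>1 * (norm x)\<^sup>2"
  define c\<^sub>1 where "c\<^sub>1 = 2 * C\<^sub>1"
  have c_pos: "0 < c\<^sub>0" "0 < c\<^sub>1"
    unfolding c\<^sub>0_def c\<^sub>1_def using C_pos by (auto intro: add_pos_nonneg)
  have \<mu>_nonneg: "0 \<le> \<mu>" using \<mu>_pos by simp
  have convex': "expected_loss M L' Y \<ge> expected_loss M L' X
      + grad (expected_loss M L') X \<bullet> (Y - X) + \<mu> / 2 * (norm (X - Y))\<^sup>2" for X Y
    unfolding expected by (rule strongly_convex)
  have min': "expected_loss M L' x \<le> expected_loss M L' Y" for Y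
    unfolding expected using min by simp
  have step: "integrable P (\<lambda>z. (norm (X n z - x))\<^sup>2)"
      "mean_sq_dist P (X (Suc n)) x
        \<le> (1 - \<rho> n * \<mu> + (\<rho> n)\<^sup>2 * c\<^sub>1) * mean_sq_dist P (X n) x + (\<rho> n)\<^sup>2 * c\<^sub>0"
    if "sgd_iterates M L \<rho> P \<omega> X" for \<rho> and P :: "'z measure" and \<omega> X n
  proof -
    note sgd = sgd_iterates_cong_AE[OF that eq]
    show int_n: "integrable P (\<lambda>z. (norm (X n z - x))\<^sup>2)"
      by (rule sgd_iterates_square_integrable[OF loss sgd convex' \<mu>_nonneg min'])
    show "mean_sq_dist P (X (Suc n)) x
        \<le> (1 - \<rho> n * \<mu> + (\<rho> n)\<^sup>2 * c\<^sub>1) * mean_sq_dist P (X n) x + (\<rho> n)\<^sup>2 * c\<^sub>0"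
      unfolding c\<^sub>0_def c\<^sub>1_def
      by (rule sgd_iterates_step(2)[OF loss sgd convex' \<mu>_nonneg min' int_n])
  qed
  have nonneg: "0 \<le> mean_sq_dist P Y x" for P :: "'z measure" and Y
    unfolding mean_sq_dist_def by simp
  have rate_nonneg: "0 \<le> \<rho> n" if "sgd_iterates M L \<rho> P \<omega> X" for \<rho> and P :: "'z measure" and \<omega> X n
    using that by (simp add: sgd_iterates_def less_imp_le)
  have eventually_le: "eventually (\<lambda>n. mean_sq_dist P (X n) x \<le> e + \<delta>) sequentially"
    if sgd: "sgd_iterates M L \<rho> P \<omega> X"
      and "eventually (\<lambda>n. \<rho> n * c\<^sub>1 \<le> \<mu> / 2 \<and> \<rho> n * \<mu> \<le> 2 \<and> 2 * \<rho> n * c\<^sub>0 \<le> \<mu> * e) sequentially"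
      and "filterlim (\<lambda>m. \<Sum>n=1..m. \<rho> n) at_top sequentially" and "0 < \<delta>"
    for \<rho> and P :: "'z measure" and \<omega> X e \<delta>
    by (rule sgd_recursion_eventually_le[OF step(2)[OF sgd] nonneg rate_nonneg[OF sgd] \<mu>_pos that(2-4)])

  show "\<exists>c\<^sub>0>0. \<exists>c\<^sub>1>0. \<forall>\<rho> (P :: 'z measure) \<omega> X. sgd_iterates M L \<rho> P \<omega> X \<longrightarrow>
      (\<forall>n. integrable P (\<lambda>z. (norm (X n z - x))\<^sup>2) \<and>
        mean_sq_dist P (X (Suc n)) x
          \<le> (1 - \<rho> n * \<mu> + (\<rho> n)\<^sup>2 * c\<^sub>1) * mean_sq_dist P (X n) x + (\<rho> n)\<^sup>2 * c\<^sub>0)"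
    using c_pos step by blast

  show "\<exists>\<rho>\<^sub>\<epsilon>>0. \<forall>\<rho> (P :: 'z measure) \<omega> X. 0 < \<rho> \<and> \<rho> < \<rho>\<^sub>\<epsilon> \<and> sgd_iterates M L (\<lambda>_. \<rho>) P \<omega> X \<longrightarrow>
      limsup (\<lambda>n. ereal (mean_sq_dist P (X (Suc n)) x)) \<le> ereal \<epsilon>" if "0 < \<epsilon>" for \<epsilon>
  \<comment> \<open>The three bounds on \<open>\<rho>\<close> are the smallness conditions of
    \<open>sgd_recursion_eventually_le\<close> with \<open>e = \<epsilon>\<close>, solved for
    \<open>\<rho>\<close>.\<close>
  proof (intro exI[of _ "min (\<mu> / (2 * c\<^sub>1)) (min (2 / \<mu>) (\<mu> * \<epsilon> / (2 * c\<^sub>0)))"] conjI allI impI)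
    show "0 < min (\<mu> / (2 * c\<^sub>1)) (min (2 / \<mu>) (\<mu> * \<epsilon> / (2 * c\<^sub>0)))"
      using c_pos \<mu>_pos \<open>0 < \<epsilon>\<close> by simp
    fix \<rho> :: real and P :: "'z measure" and \<omega> X
    assume *: "0 < \<rho> \<and> \<rho> < min (\<mu> / (2 * c\<^sub>1)) (min (2 / \<mu>) (\<mu> * \<epsilon> / (2 * c\<^sub>0)))
      \<and> sgd_iterates M L (\<lambda>_. \<rho>) P \<omega> X"
    then have "\<rho> < \<mu> / (2 * c\<^sub>1)" "\<rho> < 2 / \<mu>" "\<rho> < \<mu> * \<epsilon> / (2 * c\<^sub>0)" by auto
    then have "\<rho> * c\<^sub>1 \<le> \<mu> / 2 \<and> \<rho> * \<mu> \<le> 2 \<and> 2 * \<rho> * c\<^sub>0 \<le> \<mu> * \<epsilon>"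
      using c_pos \<mu>_pos by (simp add: field_simps)
    then have small: "eventually (\<lambda>n. \<rho> * c\<^sub>1 \<le> \<mu> / 2 \<and> \<rho> * \<mu> \<le> 2 \<and> 2 * \<rho> * c\<^sub>0 \<le> \<mu> * \<epsilon>) sequentially"
      by simp
    have "filterlim (\<lambda>m. real m * \<rho>) at_top sequentially"
      using * by (intro filterlim_at_top_mult_tendsto_pos[OF tendsto_const _ filterlim_real_sequentially]) auto
    then have diverges: "filterlim (\<lambda>m. \<Sum>n=1..m. \<rho>) at_top sequentially" by simp
    have sgd: "sgd_iterates M L (\<lambda>_. \<rho>) P \<omega> X" using * by simp
    \<comment> \<open>The recursion reaches \<open>\<epsilon>\<close> only up to an arbitrary
      \<open>\<delta>\<close>, which is removed at the level of the limsup.\<close>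
    have "limsup (\<lambda>n. ereal (mean_sq_dist P (X (Suc n)) x)) \<le> ereal \<epsilon> + ereal \<delta>" if "0 < \<delta>" for \<delta>
    proof (rule Limsup_bounded)
      have "eventually (\<lambda>n. mean_sq_dist P (X n) x \<le> \<epsilon> + \<delta>) sequentially"
        by (rule eventually_le[OF sgd small diverges that])
      then have "eventually (\<lambda>n. mean_sq_dist P (X (Suc n)) x \<le> \<epsilon> + \<delta>) sequentially"
        by (rule eventually_sequentially_Suc[THEN iffD2])
      then show "eventually (\<lambda>n. ereal (mean_sq_dist P (X (Suc n)) x) \<le> ereal \<epsilon> + ereal \<delta>) sequentially"
        by simp
    qed
    then show "limsup (\<lambda>n. ereal (mean_sq_dist P (X (Suc n)) x)) \<le> ereal \<epsilon>"
      by (rule ereal_le_epsilon2)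
  qed

  fix \<rho> and P :: "'z measure" and \<omega> X
  assume *: "sgd_iterates M L \<rho> P \<omega> X \<and> \<rho> \<longlonglongrightarrow> 0 \<and> filterlim (\<lambda>m. \<Sum>n=1..m. \<rho> n) at_top sequentially"
  then have sgd: "sgd_iterates M L \<rho> P \<omega> X" and lim: "\<rho> \<longlonglongrightarrow> 0"
    and diverges: "filterlim (\<lambda>m. \<Sum>n=1..m. \<rho> n) at_top sequentially" by auto
  show "(\<lambda>n. mean_sq_dist P (X n) x) \<longlonglongrightarrow> 0"
  proof (rule order_tendstoI)
    show "eventually (\<lambda>n. a < mean_sq_dist P (X n) x) sequentially" if "a < 0" for a
      using less_le_trans[OF that nonneg] by simp
    fix e :: real assume "0 < e"
    have ev: "eventually (\<lambda>n. \<rho> n * k < r) sequentially" if "0 < r" for k r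
      using order_tendstoD(2)[OF tendsto_mult_left_zero[OF lim, of k] that] .
    have "eventually (\<lambda>n. \<rho> n * c\<^sub>1 \<le> \<mu> / 2 \<and> \<rho> n * \<mu> \<le> 2 \<and> 2 * \<rho> n * c\<^sub>0 \<le> \<mu> * (e / 3)) sequentially"
    proof -
      have "0 < \<mu> / 2" "(0::real) < 2" "0 < \<mu> * (e / 3)" using \<mu>_pos \<open>0 < e\<close> by auto
      from ev[OF this(1), of c\<^sub>1] ev[OF this(2), of \<mu>] ev[OF this(3), of "2 * c\<^sub>0"]
      show ?thesis by eventually_elim (simp add: mult.commute mult.left_commute)
    qed
    \<comment> \<open>Thirds leave room for the strict inequality below \<open>e\<close>.\<close>
    then have "eventually (\<lambda>n. mean_sq_dist P (X n) x \<le> e / 3 + e / 3) sequentially"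
      by (rule eventually_le[OF sgd _ diverges]) (use \<open>0 < e\<close> in simp)
    then show "eventually (\<lambda>n. mean_sq_dist P (X n) x < e) sequentially"
      by eventually_elim (use \<open>0 < e\<close> in linarith)
  qed
qed

end
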